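(* Let $\mu$ be the Gibbs measure on $\Sigma_A$ of a Hölder continuous potential that is not cohomologous to a constant. Let $\psi:\mathbb N\to\mathbb N$ be such that $\psi(n)\le n$ for all $n$ sufficiently large and $\lim_{n\to\infty}\psi(n)=\infty$. Suppose there exist an increasing sequence $(n_k)_{k\ge1}$ of natural numbers and a function $g:\mathbb N\to[1,\infty)$ with $\lim_{n\to\infty}g(n)/g(n+1)=1$ such that $$\mu\left(\left\{\mathbf i\in\Sigma_A:\limsup_{k\to\infty}\frac{\log\mu([\mathbf i|_1^{n_k}])+h_\mu n_k}{\sqrt{2\rho_\mu n_k}\,g(n_k)}>1\right\}\right)=1$$ and $$\lim_{k\to\infty}\#\psi^{-1}(n_k)\,e^{-h_\mu n_k+\sqrt{2\rho_\mu n_k}\,g(n_k)}=\infty.$$ Then $$\mu\left(\left\{\mathbf i\in\Sigma_A: d(\sigma^p\mathbf i,\mathbf i)\le K^{-n_k}\text{ for some }p\in\psi^{-1}(n_k),\text{ for infinitely many }k\in\mathbb N\right\}\right)=1.$$ Moreover, $\mu(R_\psi)=1$.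
   Context: Let $K\ge 2$ be an integer and $\Sigma=\{1,\dots,K\}^{\mathbb N}$. For sequences $\mathbf i,\mathbf j$ let $|\mathbf i\wedge\mathbf j|=\inf\{n\ge 0: i_{n+1}\neq j_{n+1}\}$, and equip $\Sigma$ with the metric $d(\mathbf i,\mathbf j)=K^{-|\mathbf i\wedge\mathbf j|}$. Let $A$ be a $K\times K$ matrix with entries in $\{0,1\}$ such that for some $M\in\mathbb N$ all entries of $A^M$ are strictly positive, let $\Sigma_A=\{\mathbf i\in\Sigma: A_{i_l,i_{l+1}}=1\text{ for all } l\in\mathbb N\}$, and let $\sigma$ be the left shift on $\Sigma_A$. Let $\Sigma_{A,n}$ be the set of words $i_1\dots i_n$ with $A_{i_l,i_{l+1}}=1$ for $1\le l\le n-1$, $[w]=\{\mathbf j\in\Sigma_A:\mathbf j\text{ begins with } w\}$, and $\mathbf i|_1^n=i_1\dots i_n$. A function $f:\Sigma_A\to\mathbb R$ is Hölder continuous if $|f(\mathbf i)-f(\mathbf j)|\le b\alpha^{|\mathbf i\wedge\mathbf j|}$ for some $b>0$, $0<\alpha<1$. Its pressure is $P(f)=\lim_{n}\frac1n\log\sum_{w\in\Sigma_{A,n}}\sup_{\mathbf j\in[w]}\exp(\sum_{k=0}^{n-1}f(\sigma^k\mathbf j))$. The Gibbs measure of $f$ is the unique $\sigma$-invariant ergodic probability measure $\mu$ on $\Sigma_A$ for which there is $C>1$ with $C^{-1}\le \mu([\mathbf i|_1^n])/\exp(-nP(f)+\sum_{k=0}^{n-1}f(\sigma^k\mathbf i))\le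 C$ for all $\mathbf i,n$. Entropy: $h_\mu=\lim_n-\frac1n\sum_{w\in\Sigma_{A,n}}\mu([w])\log\mu([w])$; variance: $\rho_\mu=\lim_n\frac1n\int(\sum_{k=0}^{n-1}f(\sigma^k\mathbf i)-n\int f\,d\mu)^2d\mu(\mathbf i)$. $f$ is cohomologous to a constant if $f=g\circ\sigma-g+c$ for some continuous $g$ and constant $c$. For $\psi:\mathbb N\to\mathbb N$, $\psi^{-1}(n)=\{m\in\mathbb N:\psi(m)=n\}$, $\#$ denotes cardinality, and $R_\psi=\{\mathbf i\in\Sigma_A: d(\sigma^n\mathbf i,\mathbf i)\le K^{-\psi(n)}\text{ for infinitely many }n\}$. *)

theory Defs
  imports "HOL-Probability.Probability"
begin

text \<open>Sequences i = i_1 i_2 ... are represented as functions x :: nat => nat with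
  i_{n+1} = x n (0-based indexing). The alphabet is {1..K}.\<close>

type_synonym seq = "nat \<Rightarrow> nat"

definition mat_pow :: "nat \<Rightarrow> (nat \<Rightarrow> nat \<Rightarrow> nat) \<Rightarrow> nat \<Rightarrow> nat \<Rightarrow> nat \<Rightarrow> nat" where
  "mat_pow K A m = (rec_nat (\<lambda>a b. if a = b then 1 else 0)
      (\<lambda>_ P a b. \<Sum>c\<in>{1..K}. P a c * A c b)) m"

definition admissible_matrix :: "nat \<Rightarrow> (nat \<Rightarrow> nat \<Rightarrow> nat) \<Rightarrow> bool" where
  "admissible_matrix K A \<longleftrightarrow>
     (\<forall>a\<in>{1..K}. \<forall>b\<in>{1..K}. A a b \<in> {0, 1}) \<and>
     (\<exists>M. \<forall>a\<in>{1..K}. \<forall>b\<in>{1..K}. mat_pow K A M a b > 0)"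

definition SigmaA :: "nat \<Rightarrow> (nat \<Rightarrow> nat \<Rightarrow> nat) \<Rightarrow> seq set" where
  "SigmaA K A = {x. (\<forall>l. x l \<in> {1..K}) \<and> (\<forall>l. A (x l) (x (Suc l)) = 1)}"

definition shift :: "seq \<Rightarrow> seq" where
  "shift x = (\<lambda>l. x (Suc l))"

definition agree_len :: "seq \<Rightarrow> seq \<Rightarrow> nat" where
  "agree_len x y = (LEAST n. x n \<noteq> y n)"

definition dist_sym :: "nat \<Rightarrow> seq \<Rightarrow> seq \<Rightarrow> real" where
  "dist_sym K x y = (if x = y then 0 else 1 / real K ^ agree_len x y)"

definition words :: "nat \<Rightarrow> (nat \<Rightarrow> nat \<Rightarrow> nat) \<Rightarrow> nat \<Rightarrow> nat list set" where
  "words K A n = {w. length w = n \<and> set w \<subseteq> {1..K} \<and>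
                     (\<forall>l. Suc l < n \<longrightarrow> A (w ! l) (w ! Suc l) = 1)}"

definition cyl :: "nat \<Rightarrow> (nat \<Rightarrow> nat \<Rightarrow> nat) \<Rightarrow> nat list \<Rightarrow> seq set" where
  "cyl K A w = {x \<in> SigmaA K A. \<forall>j < length w. x j = w ! j}"

definition prefix :: "seq \<Rightarrow> nat \<Rightarrow> nat list" where
  "prefix x n = map x [0..<n]"

definition cyl_space :: "nat \<Rightarrow> (nat \<Rightarrow> nat \<Rightarrow> nat) \<Rightarrow> seq measure" where
  "cyl_space K A = sigma (SigmaA K A) {cyl K A w | w. True}"

definition birkhoff :: "(seq \<Rightarrow> real) \<Rightarrow> nat \<Rightarrow> seq \<Rightarrow> real" where
  "birkhoff f n x = (\<Sum>k<n. f ((shift ^^ k) x))"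

definition holder :: "nat \<Rightarrow> (nat \<Rightarrow> nat \<Rightarrow> nat) \<Rightarrow> (seq \<Rightarrow> real) \<Rightarrow> bool" where
  "holder K A f \<longleftrightarrow> (\<exists>b>0. \<exists>\<alpha>>0. \<alpha> < 1 \<and>
     (\<forall>x\<in>SigmaA K A. \<forall>y\<in>SigmaA K A. x \<noteq> y \<longrightarrow> \<bar>f x - f y\<bar> \<le> b * \<alpha> ^ agree_len x y))"

definition pressure :: "nat \<Rightarrow> (nat \<Rightarrow> nat \<Rightarrow> nat) \<Rightarrow> (seq \<Rightarrow> real) \<Rightarrow> real" where
  "pressure K A f = lim (\<lambda>n. 1 / real n *
      ln (\<Sum>w\<in>words K A n. (SUP y\<in>cyl K A w. exp (birkhoff f n y))))"

definition continuous_sym :: "nat \<Rightarrow> (nat \<Rightarrow> nat \<Rightarrow> nat) \<Rightarrow> (seq \<Rightarrow> real) \<Rightarrow> bool" where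
  "continuous_sym K A g \<longleftrightarrow> (\<forall>x\<in>SigmaA K A. \<forall>\<epsilon>>0. \<exists>\<delta>>0. \<forall>y\<in>SigmaA K A.
      dist_sym K x y < \<delta> \<longrightarrow> \<bar>g y - g x\<bar> < \<epsilon>)"

definition cohomologous_const :: "nat \<Rightarrow> (nat \<Rightarrow> nat \<Rightarrow> nat) \<Rightarrow> (seq \<Rightarrow> real) \<Rightarrow> bool" where
  "cohomologous_const K A f \<longleftrightarrow> (\<exists>g c. continuous_sym K A g \<and>
      (\<forall>x\<in>SigmaA K A. f x = g (shift x) - g x + c))"

definition gibbs_measure ::
  "nat \<Rightarrow> (nat \<Rightarrow> nat \<Rightarrow> nat) \<Rightarrow> (seq \<Rightarrow> real) \<Rightarrow> seq measure \<Rightarrow> bool" where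
  "gibbs_measure K A f \<mu> \<longleftrightarrow>
     prob_space \<mu> \<and> sets \<mu> = sets (cyl_space K A) \<and>
     shift \<in> \<mu> \<rightarrow>\<^sub>M \<mu> \<and> distr \<mu> \<mu> shift = \<mu> \<and>
     (\<forall>E\<in>sets \<mu>. shift -` E \<inter> space \<mu> = E \<longrightarrow> measure \<mu> E = 0 \<or> measure \<mu> E = 1) \<and>
     (\<exists>C>1. \<forall>x\<in>SigmaA K A. \<forall>n.
        inverse C \<le> measure \<mu> (cyl K A (prefix x n)) /
                      exp (- real n * pressure K A f + birkhoff f n x) \<and>
        measure \<mu> (cyl K A (prefix x n)) /
                      exp (- real n * pressure K A f + birkhoff f n x) \<le> C)"

definition entropy_sym :: "nat \<Rightarrow> (nat \<Rightarrow> nat \<Rightarrow> nat) \<Rightarrow> seq measure \<Rightarrow> real" where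
  "entropy_sym K A \<mu> = lim (\<lambda>n. - 1 / real n *
      (\<Sum>w\<in>words K A n. measure \<mu> (cyl K A w) * ln (measure \<mu> (cyl K A w))))"

definition variance_sym :: "(seq \<Rightarrow> real) \<Rightarrow> seq measure \<Rightarrow> real" where
  "variance_sym f \<mu> = lim (\<lambda>n. 1 / real n *
      (\<integral>x. (birkhoff f n x - real n * (\<integral>y. f y \<partial>\<mu>))\<^sup>2 \<partial>\<mu>))"

text \<open>psi^{-1}(n), with the domain N = {1,2,...}.\<close>
definition preim :: "(nat \<Rightarrow> nat) \<Rightarrow> nat \<Rightarrow> nat set" where
  "preim \<psi> n = {m. m \<ge> 1 \<and> \<psi> m = n}"

definition R_psi :: "nat \<Rightarrow> (nat \<Rightarrow> nat \<Rightarrow> nat) \<Rightarrow> (nat \<Rightarrow> nat) \<Rightarrow> seq set" where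
  "R_psi K A \<psi> = {x \<in> SigmaA K A.
      infinite {n. n \<ge> 1 \<and> dist_sym K ((shift ^^ n) x) x \<le> 1 / real K ^ \<psi> n}}"

end

theory Submission
  imports Defs
begin

text \<open>
  The Gibbs inequality makes \<open>\<mu>\<close> quasi-Bernoulli: \<open>\<mu>(U \<inter> \<sigma>\<^sup>-\<^sup>n V)\<close> is comparable to \<open>\<mu>(U) \<mu>(V)\<close> for events \<open>U\<close>
  of depth \<open>n\<close>, the lower bound requiring a gap of fixed length \<open>G\<close>. If \<open>w\<close> is a word of length \<open>n\<close> and
  \<open>N\<close> times \<open>p \<ge> n + G\<close> are given with \<open>N \<mu>[w] \<ge> 1\<close>, the second moment method therefore shows that a fixed
  proportion of \<open>[w]\<close> returns to \<open>[w]\<close> at one of these times; clustering of returns is harmless since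
  \<open>\<mu>[w\<^sub>1 \<dots> w\<^sub>r]\<close> is summable in \<open>r\<close>. By the two limit hypotheses almost every point meets such words \<open>w\<close> at
  infinitely many of the levels \<open>n\<^sub>k\<close>, so stopping at the first one gives a uniform lower bound on the
  proportion of every event of finite depth that returns, and a density argument turns this into probability one.

  This argument uses that \<open>variance_sym f \<mu>\<close> is not negative, which is not clear from the definition: \<open>lim\<close> is
  an unspecified number when the limit does not exist. Instead of proving convergence, a
  negative value is treated separately. It suffices then that \<open>\<mu>[i\<^sub>1 \<dots> i\<^sub>n] \<ge> exp (- h n - \<delta> \<surd>n)\<close> with
  probability bounded below, which follows from the linear growth of the second moments of the centred
  Birkhoff sums. The latter is obtained from transfer operators, by comparing \<open>\<mu>\<close> with the weights
  \<open>exp (S\<^sub>n f y)\<close> on the preimages \<open>y\<close> of a point under \<open>\<sigma>\<^sup>n\<close>.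
\<close>

section \<open>Quasi-independence of cylinders\<close>

lemma shift_pow: "(shift ^^ n) x j = x (n + j)"
proof (induction n arbitrary: j)
  case (Suc n)
  then show ?case by (simp add: shift_def)
qed simp

lemma shift_pow_add: "(shift ^^ n) ((shift ^^ k) x) = (shift ^^ (n + k)) x"
  by (simp add: funpow_add)

lemma length_prefix [simp]: "length (prefix x n) = n"
  by (simp add: prefix_def)

lemma nth_prefix [simp]: "j < n \<Longrightarrow> prefix x n ! j = x j"
  by (simp add: prefix_def)

lemma prefix_eq_iff: "prefix x n = prefix y n \<longleftrightarrow> (\<forall>j<n. x j = y j)"
  by (auto simp: list_eq_iff_nth_eq)

lemma prefix_eq_conv: "prefix x n = w \<longleftrightarrow> length w = n \<and> (\<forall>j<n. x j = w ! j)"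
  by (auto simp: list_eq_iff_nth_eq)

lemma take_prefix: "take n (prefix x (n + k)) = prefix x n"
  by (auto simp: list_eq_iff_nth_eq)

lemma take_prefix_le: "n \<le> k \<Longrightarrow> take n (prefix x k) = prefix x n"
  by (auto simp: list_eq_iff_nth_eq)

lemma drop_prefix: "drop n (prefix x (n + k)) = prefix ((shift ^^ n) x) k"
  by (auto simp: list_eq_iff_nth_eq shift_pow)

lemma birkhoff_0 [simp]: "birkhoff f 0 x = 0"
  by (simp add: birkhoff_def)

lemma birkhoff_add: "birkhoff f (n + k) x = birkhoff f n x + birkhoff f k ((shift ^^ n) x)"
  unfolding birkhoff_def shift_pow_add by (induction k) (simp_all add: add.commute add.left_commute)

lemma birkhoff_1 [simp]: "birkhoff f (Suc 0) x = f x"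
  by (simp add: birkhoff_def)

text \<open>Turns distance conditions into conditions on symbols. For distinct sequences
  \<open>agree_len\<close> is the first index of disagreement, and powers of K \<ge> 2 are ordered
  like their exponents.\<close>

lemma dist_sym_le_iff:
  assumes "K \<ge> 2"
  shows "dist_sym K x y \<le> 1 / real K ^ n \<longleftrightarrow> (\<forall>j<n. x j = y j)"
proof (cases "x = y")
  case True
  then show ?thesis by (simp add: dist_sym_def)
next
  case False
  then obtain j where j: "x j \<noteq> y j" by blast
  have neq: "x (agree_len x y) \<noteq> y (agree_len x y)"
    unfolding agree_len_def by (rule LeastI[of "\<lambda>n. x n \<noteq> y n", OF j])
  have eq: "x i = y i" if "i < agree_len x y" for i
    using not_less_Least[of i "\<lambda>n. x n \<noteq> y n"] that by (auto simp: agree_len_def)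
  have "dist_sym K x y \<le> 1 / real K ^ n \<longleftrightarrow> real K ^ n \<le> real K ^ agree_len x y"
    using False assms by (simp add: dist_sym_def field_simps)
  also have "\<dots> \<longleftrightarrow> n \<le> agree_len x y"
    using assms by simp
  also have "\<dots> \<longleftrightarrow> (\<forall>j<n. x j = y j)"
    using neq eq by (metis leI less_le_trans)
  finally show ?thesis .
qed

section \<open>Elementary inequalities and the second moment method\<close>

lemma exp_minus_1_le: "0 \<le> t \<Longrightarrow> exp t - 1 \<le> t * exp (t :: real)"
  using exp_ge_add_one_self[of "- t"] by (simp add: exp_minus field_simps)

text \<open>The weights sum to 1, so c is its own average and the triangle inequality applies term
  by term.\<close>

lemma weighted_deviation:
  fixes p :: "'a \<Rightarrow> real"
  assumes "\<And>z. z \<in> Z \<Longrightarrow> p z \<ge> 0" "sum p Z = 1" "\<And>z. z \<in> Z \<Longrightarrow> \<bar>c - h z\<bar> \<le> D"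
  shows "\<bar>c - (\<Sum>z\<in>Z. p z * h z)\<bar> \<le> D"
proof -
  have "c - (\<Sum>z\<in>Z. p z * h z) = (\<Sum>z\<in>Z. p z * (c - h z))"
    using assms(2) by (simp add: right_diff_distrib sum_subtractf sum_distrib_right[symmetric])
  also have "\<bar>\<dots>\<bar> \<le> (\<Sum>z\<in>Z. p z * D)"
    using assms by (intro order_trans[OF sum_abs] sum_mono) (auto simp: abs_mult intro: mult_left_mono)
  also have "\<dots> = D" using assms(2) by (simp add: sum_distrib_right[symmetric])
  finally show ?thesis .
qed

text \<open>Serves to sum over the gaps between a fixed time and other return times: distinct times
  on one side give distinct gaps, so each r < n is counted at most once.\<close>

lemma sum_card_shifted_le:
  fixes h :: "nat \<Rightarrow> real"
  assumes "finite T" "inj_on d T" "\<And>r. h r \<ge> 0"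
  shows "(\<Sum>q\<in>T. if d q < n then h (d q) else 0) \<le> (\<Sum>r<n. h r)"
proof -
  have "(\<Sum>q\<in>T. if d q < n then h (d q) else 0) = (\<Sum>q\<in>{q\<in>T. d q < n}. h (d q))"
    using assms(1) by (simp add: sum.inter_filter)
  also have "\<dots> = (\<Sum>r\<in>d ` {q\<in>T. d q < n}. h r)"
    using assms(2) by (subst sum.reindex) (auto intro: inj_on_subset)
  also have "\<dots> \<le> (\<Sum>r<n. h r)" using assms(3) by (intro sum_mono2) auto
  finally show ?thesis .
qed

lemma (in finite_measure) measure_sym_diff_triangle:
  assumes "D \<in> sets M" "E \<in> sets M" "H \<in> sets M"
  shows "measure M (sym_diff D H) \<le> measure M (sym_diff D E) + measure M (sym_diff E H)"
proof -
  have "measure M (sym_diff D H) \<le> measure M (sym_diff D E \<union> sym_diff E H)"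
    using assms by (intro finite_measure_mono) auto
  also have "\<dots> \<le> measure M (sym_diff D E) + measure M (sym_diff E H)"
    using assms by (intro measure_Un_le) auto
  finally show ?thesis .
qed

text \<open>Integrating \<open>1\<^bsub>{Z > 0}\<^esub> \<ge> 2tZ - t\<^sup>2Z\<^sup>2\<close> for the number \<open>Z\<close> of events \<open>E p\<close> that occur is the second moment method
  with the free parameter \<open>t\<close>.\<close>
lemma (in prob_space) second_moment:
  assumes T: "finite T" and E: "\<And>p. p \<in> T \<Longrightarrow> E p \<in> sets M"
  shows "measure M (\<Union>p\<in>T. E p) \<ge> 2 * t * (\<Sum>p\<in>T. measure M (E p))
      - t\<^sup>2 * (\<Sum>p\<in>T. \<Sum>q\<in>T. measure M (E p \<inter> E q))"
proof -
  let ?Z = "\<lambda>x. \<Sum>p\<in>T. indicator (E p) x :: real"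
  have ptw: "2 * t * ?Z x - t\<^sup>2 * (?Z x)\<^sup>2 \<le> indicator (\<Union>p\<in>T. E p) x" for x
  proof (cases "x \<in> (\<Union>p\<in>T. E p)")
    case True
    have "0 \<le> (1 - t * ?Z x)\<^sup>2" by simp
    with True show ?thesis by (simp add: power2_eq_square algebra_simps)
  next
    case False
    then have "?Z x = 0" by (intro sum.neutral) auto
    with False show ?thesis by simp
  qed
  have Z2: "(?Z x)\<^sup>2 = (\<Sum>p\<in>T. \<Sum>q\<in>T. indicator (E p \<inter> E q) x)" for x
    by (simp add: power2_eq_square sum_product indicator_inter_arith)
  have int1: "integrable M (\<lambda>x. indicator (E p) x :: real)" if "p \<in> T" for p
    using E[OF that] by (simp add: integrable_indicator_iff emeasure_eq_measure)
  have int2: "integrable M (\<lambda>x. indicator (E p \<inter> E q) x :: real)" if "p \<in> T" "q \<in> T" for p q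
    using E that by (simp add: integrable_indicator_iff emeasure_eq_measure)
  have sp: "E p \<inter> space M = E p" if "p \<in> T" for p
    using sets.sets_into_space[OF E[OF that]] by auto
  have UE: "(\<Union>p\<in>T. E p) \<in> sets M" using T E by (intro sets.finite_UN) auto
  have "2 * t * (\<Sum>p\<in>T. measure M (E p)) - t\<^sup>2 * (\<Sum>p\<in>T. \<Sum>q\<in>T. measure M (E p \<inter> E q))
      = (\<integral>x. 2 * t * ?Z x - t\<^sup>2 * (?Z x)\<^sup>2 \<partial>M)"
  proof -
    have "(\<integral>x. ?Z x \<partial>M) = (\<Sum>p\<in>T. measure M (E p))"
      using int1 sp by (subst Bochner_Integration.integral_sum) auto
    moreover have "(\<integral>x. (?Z x)\<^sup>2 \<partial>M) = (\<Sum>p\<in>T. \<Sum>q\<in>T. measure M (E p \<inter> E q))"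
    proof -
      have "(\<integral>x. (?Z x)\<^sup>2 \<partial>M) = (\<Sum>p\<in>T. \<Sum>q\<in>T. measure M (E p \<inter> E q \<inter> space M))"
        unfolding Z2 using int2
        by (simp add: Bochner_Integration.integral_sum Bochner_Integration.integrable_sum)
      also have "\<dots> = (\<Sum>p\<in>T. \<Sum>q\<in>T. measure M (E p \<inter> E q))"
        using sp by (intro sum.cong refl) (metis Int_assoc)
      finally show ?thesis .
    qed
    moreover have "integrable M (\<lambda>x. ?Z x)" using int1 by (intro Bochner_Integration.integrable_sum)
    moreover have "integrable M (\<lambda>x. (?Z x)\<^sup>2)"
      unfolding Z2 using int2 by (intro Bochner_Integration.integrable_sum)
    ultimately show ?thesis by simp
  qed
  also have "\<dots> \<le> (\<integral>x. indicator (\<Union>p\<in>T. E p) x \<partial>M)"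
  proof (rule integral_mono)
    have "integrable M (\<lambda>x. ?Z x)" using int1 by (intro Bochner_Integration.integrable_sum)
    moreover have "integrable M (\<lambda>x. (?Z x)\<^sup>2)"
      unfolding Z2 using int2 by (intro Bochner_Integration.integrable_sum)
    ultimately show "integrable M (\<lambda>x. 2 * t * ?Z x - t\<^sup>2 * (?Z x)\<^sup>2)" by simp
    show "integrable M (\<lambda>x. indicator (\<Union>p\<in>T. E p) x :: real)"
      using UE by (simp add: integrable_indicator_iff emeasure_eq_measure)
  qed (rule ptw)
  also have "\<dots> = measure M (\<Union>p\<in>T. E p)"
    using sets.sets_into_space[OF UE] by (simp add: Int_absorb2)
  finally show ?thesis .
qed

text \<open>\<open>Suc G\<close> is an exponent at which the power of the matrix is positive: any
  two symbols are joined by a path of exactly \<open>Suc G\<close> steps, with G symbols strictly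
  between them.\<close>

locale subshift =
  fixes K :: nat and A :: "nat \<Rightarrow> nat \<Rightarrow> nat" and G :: nat
  assumes K2: "K \<ge> 2"
    and path: "\<And>a b. a \<in> {1..K} \<Longrightarrow> b \<in> {1..K} \<Longrightarrow>
      \<exists>\<pi>. \<pi> 0 = a \<and> \<pi> (Suc G) = b \<and> (\<forall>i\<le>G. A (\<pi> i) (\<pi> (Suc i)) = 1) \<and> (\<forall>i. \<pi> i \<in> {1..K})"
begin

abbreviation X :: "seq set" where "X \<equiv> SigmaA K A"
abbreviation cy :: "nat list \<Rightarrow> seq set" where "cy \<equiv> cyl K A"
abbreviation wo :: "nat \<Rightarrow> nat list set" where "wo \<equiv> words K A"

text \<open>Events of depth n. The set U may contain words that are not admissible; they contribute
  nothing, so unions and complements can be formed on sets of words without further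
  conditions.\<close>

definition cset :: "nat \<Rightarrow> nat list set \<Rightarrow> seq set" where
  "cset n U = {x \<in> X. prefix x n \<in> U}"

lemma shift_X: "x \<in> X \<Longrightarrow> (shift ^^ n) x \<in> X"
  by (simp add: SigmaA_def shift_pow)

lemma prefix_words: "x \<in> X \<Longrightarrow> prefix x n \<in> wo n"
  by (auto simp: SigmaA_def words_def prefix_def)

lemma finite_words: "finite (wo n)"
proof -
  have "wo n \<subseteq> {w. set w \<subseteq> {1..K} \<and> length w = n}"
    by (auto simp: words_def)
  then show ?thesis
    using finite_lists_length_eq[of "{1..K}" n] finite_subset by blast
qed

text \<open>Mixing in symbolic form: a path from the last symbol of w to the first symbol of x puts
  G symbols between them.\<close>

lemma connect:
  assumes w: "w \<in> wo n" and x: "x \<in> X"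
  obtains y where "y \<in> X" "prefix y n = w" "(shift ^^ (n + G)) y = x"
proof -
  \<comment> \<open>The empty word has no last symbol; 1 is an arbitrary start in the
    alphabet.\<close>
  define a where "a = (if n = 0 then 1 else w ! (n - 1))"
  have wK: "w ! j \<in> {1..K}" if "j < n" for j
    using that w unfolding words_def by (auto dest: nth_mem)
  have aK: "a \<in> {1..K}"
    using wK[of "n - 1"] K2 by (auto simp: a_def)
  have xK: "x j \<in> {1..K}" "A (x j) (x (Suc j)) = 1" for j
    using x by (auto simp: SigmaA_def)
  obtain \<pi> where p: "\<pi> 0 = a" "\<pi> (Suc G) = x 0" "\<And>i. i \<le> G \<Longrightarrow> A (\<pi> i) (\<pi> (Suc i)) = 1"
    "\<And>i. \<pi> i \<in> {1..K}"
    using path[OF aK xK(1)[of 0]] by blast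
  \<comment> \<open>Only \<open>\<pi> 1\<close>, ..., \<open>\<pi> G\<close> are inserted:
    \<open>\<pi> (Suc G)\<close> is the first symbol of x, and \<open>\<pi> 0\<close> is the last
    symbol of w, or dropped if w is empty.\<close>
  define y where "y i = (if i < n then w ! i else if i < n + G then \<pi> (Suc (i - n)) else x (i - (n + G)))" for i
  have "A (y l) (y (Suc l)) = 1" for l
  proof -
    consider "Suc l < n" | "Suc l = n" | "n \<le> l" "l < n + G" | "n + G \<le> l" by linarith
    then show ?thesis
    proof cases
      case 1
      then show ?thesis using w by (auto simp: y_def words_def)
    next
      case 2
      then have "y l = \<pi> 0" using p by (auto simp: y_def a_def)
      moreover have "y (Suc l) = \<pi> (Suc 0)" using 2 p by (auto simp: y_def)
      ultimately show ?thesis using p(3)[of 0] by simp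
    next
      case 3
      have "y l = \<pi> (Suc (l - n))" using 3 by (simp add: y_def)
      moreover have "y (Suc l) = \<pi> (Suc (Suc (l - n)))"
      proof (cases "Suc l < n + G")
        case True
        then show ?thesis using 3 by (simp add: y_def Suc_diff_le)
      next
        case False
        then have "Suc (l - n) = G" using 3 by linarith
        moreover have "Suc l - (n + G) = 0" using False 3 by linarith
        ultimately show ?thesis using False 3 p(2) by (simp add: y_def)
      qed
      ultimately show ?thesis using p(3)[of "Suc (l - n)"] 3 by simp
    next
      case 4
      then show ?thesis using xK(2)[of "l - (n + G)"] by (simp add: y_def Suc_diff_le)
    qed
  qed
  moreover have "y l \<in> {1..K}" for l
    unfolding y_def using wK p(4) xK(1) by simp
  ultimately have "y \<in> X" by (simp add: SigmaA_def)
  moreover have "prefix y n = w"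
    using w by (auto simp: prefix_eq_conv words_def y_def)
  moreover have "(shift ^^ (n + G)) y = x"
    by (rule ext) (simp add: y_def shift_pow)
  ultimately show ?thesis using that by blast
qed

lemma cyl_eq_cset: "length w = n \<Longrightarrow> cy w = cset n {w}"
  by (auto simp: cyl_def cset_def prefix_eq_conv)

lemma cyl_prefix: "cy (prefix x n) = {y \<in> X. \<forall>j<n. y j = x j}"
  by (auto simp: cyl_def)

lemma cset_UN: "cset n U = (\<Union>w\<in>U \<inter> wo n. cy w)"
proof (intro set_eqI iffI)
  fix x assume "x \<in> cset n U"
  then show "x \<in> (\<Union>w\<in>U \<inter> wo n. cy w)"
    using prefix_words by (auto simp: cset_def cyl_def intro!: bexI[of _ "prefix x n"])
next
  fix x assume "x \<in> (\<Union>w\<in>U \<inter> wo n. cy w)"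
  then obtain w where w: "w \<in> U" "w \<in> wo n" "x \<in> cy w" by blast
  then have "prefix x n = w" by (simp add: prefix_eq_conv cyl_def words_def)
  with w show "x \<in> cset n U" by (simp add: cset_def cyl_def)
qed

lemma cset_extend: "n \<le> k \<Longrightarrow> cset n U = cset k {w. take n w \<in> U}"
  by (simp add: cset_def take_prefix_le)

lemma cset_subset: "cset n U \<subseteq> X"
  by (auto simp: cset_def)

lemma cset_shift:
  "{x \<in> cset n U. (shift ^^ n) x \<in> cset k V} = cset (n + k) {w. take n w \<in> U \<and> drop n w \<in> V}"
  by (auto simp: cset_def take_prefix drop_prefix shift_X)

end

text \<open>Hoelder continuity is stated for every common prefix length n instead of the exact
  agreement length, which also covers x = y. The Gibbs inequality is multiplied out; P stands for
  the pressure.\<close>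

locale gibbs_system = subshift + prob_space \<mu> for \<mu> :: "seq measure" +
  fixes f :: "seq \<Rightarrow> real" and b \<alpha> P C :: real
  assumes sets_mu: "sets \<mu> = sets (cyl_space K A)"
    and shift_meas [measurable]: "shift \<in> \<mu> \<rightarrow>\<^sub>M \<mu>"
    and shift_distr: "distr \<mu> \<mu> shift = \<mu>"
    and alpha: "0 < \<alpha>" "\<alpha> < 1" and b: "b > 0"
    and variation: "\<And>x y n. x \<in> SigmaA K A \<Longrightarrow> y \<in> SigmaA K A \<Longrightarrow> (\<forall>j<n. x j = y j) \<Longrightarrow>
          \<bar>f x - f y\<bar> \<le> b * \<alpha> ^ n"
    and C: "C > 1"
    and gibbs_lower: "\<And>x n. x \<in> SigmaA K A \<Longrightarrow>
          exp (birkhoff f n x - real n * P) \<le> C * measure \<mu> (cyl K A (prefix x n))"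
    and gibbs_upper: "\<And>x n. x \<in> SigmaA K A \<Longrightarrow>
          measure \<mu> (cyl K A (prefix x n)) \<le> C * exp (birkhoff f n x - real n * P)"
begin

section \<open>Measurability, invariance and positivity on cylinders\<close>

abbreviation m :: "nat list \<Rightarrow> real" where "m w \<equiv> measure \<mu> (cyl K A w)"
abbreviation S :: "nat \<Rightarrow> seq \<Rightarrow> real" where "S \<equiv> birkhoff f"

lemma space_mu: "space \<mu> = X"
proof -
  have "space (cyl_space K A) = X"
    unfolding cyl_space_def by (rule space_measure_of) (auto simp: cyl_def)
  with sets_eq_imp_space_eq[OF sets_mu] show ?thesis by simp
qed

lemma sets_cyl: "sets \<mu> = sigma_sets X {cy w | w. True}"
  unfolding sets_mu cyl_space_def by (rule sets_measure_of) (auto simp: cyl_def)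

lemma X_nonempty: "X \<noteq> {}"
  using not_empty space_mu by simp

lemma meas_cy [measurable]: "cy w \<in> sets \<mu>"
  unfolding sets_cyl by (rule sigma_sets.Basic) blast

lemma meas_X [measurable]: "X \<in> sets \<mu>"
  using sets.top[of \<mu>] space_mu by simp

lemma meas_cset [measurable]: "cset n U \<in> sets \<mu>"
  unfolding cset_UN using finite_words by (intro sets.finite_UN) auto

lemma shift_pow_meas [measurable]: "(shift ^^ n) \<in> \<mu> \<rightarrow>\<^sub>M \<mu>"
  by (induction n) (auto intro: measurable_comp)

lemma shift_pow_distr: "distr \<mu> \<mu> (shift ^^ n) = \<mu>"
proof (induction n)
  case (Suc n)
  have "distr \<mu> \<mu> (shift ^^ Suc n) = distr (distr \<mu> \<mu> (shift ^^ n)) \<mu> shift"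
    by (subst distr_distr) (auto simp: comp_def)
  then show ?case by (simp only: Suc.IH shift_distr)
next
  case 0
  show ?case by (simp add: distr_id2 id_def)
qed

lemma words_extend:
  assumes "w \<in> wo n"
  obtains x where "x \<in> X" "prefix x n = w"
proof -
  obtain z where "z \<in> X" using X_nonempty by blast
  from connect[OF assms this] that show ?thesis by metis
qed

lemma m_pos: "w \<in> wo n \<Longrightarrow> m w > 0"
proof -
  assume "w \<in> wo n"
  then obtain x where x: "x \<in> X" "prefix x n = w" using words_extend by metis
  have "0 < exp (birkhoff f n x - real n * P)" by simp
  also have "\<dots> \<le> C * m w" using gibbs_lower[OF x(1), of n] x(2) by simp
  finally show "m w > 0" using C by (simp add: zero_less_mult_iff)
qed

lemma measure_cset: "measure \<mu> (cset n U) = (\<Sum>w\<in>U \<inter> wo n. m w)"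
  unfolding cset_UN
proof (rule finite_measure_finite_Union)
  show "disjoint_family_on cy (U \<inter> wo n)"
    by (auto simp: disjoint_family_on_def cyl_def words_def list_eq_iff_nth_eq)
qed (use finite_words in auto)

lemma sum_words: "(\<Sum>w\<in>wo n. m w) = 1"
proof -
  have "cset n UNIV = space \<mu>" by (auto simp: cset_def space_mu)
  with measure_cset[of n UNIV] prob_space show ?thesis by simp
qed

text \<open>A bound for the modulus of f on \<open>X\<close>: with n = 0 the variation estimate
  compares every value with the one at a fixed point.\<close>

definition F :: real where "F = \<bar>f (SOME z. z \<in> X)\<bar> + b"

lemma F: "F \<ge> 0" "x \<in> X \<Longrightarrow> \<bar>f x\<bar> \<le> F"
proof -
  have "(SOME z. z \<in> X) \<in> X"
    using X_nonempty by (simp add: some_in_eq)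
  then show "x \<in> X \<Longrightarrow> \<bar>f x\<bar> \<le> F"
    using variation[of x "SOME z. z \<in> X" 0] unfolding F_def by fastforce
  show "F \<ge> 0" using b by (simp add: F_def)
qed

lemma S_bound: "x \<in> X \<Longrightarrow> \<bar>S n x\<bar> \<le> real n * F"
proof -
  assume x: "x \<in> X"
  have "\<bar>S n x\<bar> \<le> (\<Sum>k<n. \<bar>f ((shift ^^ k) x)\<bar>)"
    unfolding birkhoff_def by (rule sum_abs)
  also have "\<dots> \<le> (\<Sum>k<n. F)" by (intro sum_mono F shift_X x)
  finally show ?thesis by simp
qed

text \<open>Birkhoff sums are additive along the orbit, so the exponentials multiply. The Gibbs
  inequality is used once from above and twice from below, whence C ^ 3.\<close>

lemma quasi_mult_upper: 
  assumes "x \<in> X"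
  shows "m (prefix x (n + k)) \<le> C ^ 3 * m (prefix x n) * m (prefix ((shift ^^ n) x) k)"
proof -
  let ?y = "(shift ^^ n) x"
  have "m (prefix x (n + k)) \<le> C * exp (S (n + k) x - real (n + k) * P)"
    by (rule gibbs_upper[OF assms])
  also have "\<dots> = C * (exp (S n x - real n * P) * exp (S k ?y - real k * P))"
    unfolding birkhoff_add exp_add[symmetric] by (simp add: algebra_simps)
  also have "\<dots> \<le> C * ((C * m (prefix x n)) * (C * m (prefix ?y k)))"
    using C by (intro mult_left_mono mult_mono gibbs_lower assms shift_X) auto
  finally show ?thesis by (simp add: power3_eq_cube algebra_simps)
qed

text \<open>C ^ 3 again comes from three uses of the Gibbs inequality; the exponential is a lower
  bound for the weight of the G symbols in the gap.\<close>

definition c1 :: real where "c1 = exp (- real G * (F + \<bar>P\<bar>)) / C ^ 3"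

lemma c1_pos: "c1 > 0" using C by (simp add: c1_def)

lemma quasi_mult_lower:
  assumes "x \<in> X"
  shows "m (prefix x (n + G + k)) \<ge> c1 * m (prefix x n) * m (prefix ((shift ^^ (n + G)) x) k)"
proof -
  let ?y = "(shift ^^ (n + G)) x" and ?z = "(shift ^^ n) x"
  have "S G ?z - real G * P \<ge> - real G * (F + \<bar>P\<bar>)"
  proof -
    have "\<bar>S G ?z\<bar> \<le> real G * F" by (intro S_bound shift_X assms)
    moreover have "real G * P \<le> real G * \<bar>P\<bar>" by (intro mult_left_mono) auto
    ultimately show ?thesis by (simp add: algebra_simps)
  qed
  then have e: "exp (- real G * (F + \<bar>P\<bar>)) \<le> exp (S G ?z - real G * P)" by simp
  have "(m (prefix x n) / C) * exp (- real G * (F + \<bar>P\<bar>)) * (m (prefix ?y k) / C)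
      \<le> exp (S n x - real n * P) * exp (S G ?z - real G * P) * exp (S k ?y - real k * P)"
  proof (intro mult_mono e)
    show "m (prefix x n) / C \<le> exp (S n x - real n * P)"
      using gibbs_upper[OF assms, of n] C by (simp add: field_simps)
    show "m (prefix ?y k) / C \<le> exp (S k ?y - real k * P)"
      using gibbs_upper[OF shift_X[OF assms], of "n + G" k] C by (simp add: field_simps)
  qed (use C in auto)
  also have "\<dots> = exp (S (n + G + k) x - real (n + G + k) * P)"
    unfolding birkhoff_add exp_add[symmetric] by (simp add: algebra_simps)
  also have "\<dots> \<le> C * m (prefix x (n + G + k))" by (rule gibbs_lower[OF assms])
  finally show ?thesis using C by (simp add: c1_def power3_eq_cube field_simps)
qed

lemma sum_times:
  "(\<Sum>(u, v)\<in>U \<times> V. a * m u * m v) = a * (\<Sum>u\<in>U. m u) * (\<Sum>v\<in>V. m v)"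
  by (simp add: sum.cartesian_product[symmetric] sum_distrib_left[symmetric] sum_distrib_right[symmetric])

text \<open>Cutting a word after n symbols is injective, so the sum over the words of the event is
  at most the full double sum over pairs of words.\<close>

lemma quasi_indep_upper:
  "measure \<mu> {x \<in> cset n U. (shift ^^ n) x \<in> cset k V}
     \<le> C ^ 3 * measure \<mu> (cset n U) * measure \<mu> (cset k V)"
proof -
  let ?W = "{w. take n w \<in> U \<and> drop n w \<in> V} \<inter> wo (n + k)"
  let ?\<iota> = "\<lambda>w. (take n w, drop n w)"
  have W: "take n w \<in> U \<inter> wo n \<and> drop n w \<in> V \<inter> wo k \<and> m w \<le> C ^ 3 * m (take n w) * m (drop n w)"
    if w: "w \<in> ?W" for w
  proof -
    obtain x where x: "x \<in> X" "prefix x (n + k) = w" using words_extend w by blast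
    then have "take n w = prefix x n" "drop n w = prefix ((shift ^^ n) x) k"
      using take_prefix drop_prefix by metis+
    then show ?thesis using w x quasi_mult_upper[OF x(1), of n k] prefix_words shift_X by force
  qed
  have inj: "inj_on ?\<iota> ?W"
    by (rule inj_onI) (metis append_take_drop_id prod.inject)
  have "(\<Sum>w\<in>?W. m w) \<le> (\<Sum>w\<in>?W. C ^ 3 * m (take n w) * m (drop n w))"
    by (intro sum_mono) (use W in blast)
  also have "\<dots> = (\<Sum>(u, v)\<in>?\<iota> ` ?W. C ^ 3 * m u * m v)"
    by (subst sum.reindex[OF inj]) simp
  also have "\<dots> \<le> (\<Sum>(u, v)\<in>(U \<inter> wo n) \<times> (V \<inter> wo k). C ^ 3 * m u * m v)"
    using W C finite_words by (intro sum_mono2) auto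
  also have "\<dots> = C ^ 3 * (\<Sum>u\<in>U \<inter> wo n. m u) * (\<Sum>v\<in>V \<inter> wo k. m v)"
    by (rule sum_times)
  finally show ?thesis by (simp add: cset_shift measure_cset)
qed

text \<open>The lower bound must reach every pair of words: each pair is realised by a point with G
  symbols in between, which is what the gap is for.\<close>

lemma quasi_indep_lower:
  "measure \<mu> {x \<in> cset n U. (shift ^^ (n + G)) x \<in> cset k V}
     \<ge> c1 * measure \<mu> (cset n U) * measure \<mu> (cset k V)"
proof -
  let ?I = "(U \<inter> wo n) \<times> (V \<inter> wo k)"
  have "\<exists>x\<in>X. prefix x n = fst p \<and> prefix ((shift ^^ (n + G)) x) k = snd p" if p: "p \<in> ?I" for p
  proof -
    have w: "fst p \<in> wo n" "snd p \<in> wo k" using p by auto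
    obtain y where y: "y \<in> X" "prefix y k = snd p" using words_extend[OF w(2)] by metis
    obtain x where x: "x \<in> X" "prefix x n = fst p" "(shift ^^ (n + G)) x = y"
      using connect[OF w(1) y(1)] by metis
    show ?thesis using x y by (intro bexI[of _ x]) auto
  qed
  \<comment> \<open>One filling of the gap is chosen for each pair; the pair can be read off from
    the resulting word, so these words are distinct.\<close>
  then obtain \<xi> where \<xi>: "\<And>p. p \<in> ?I \<Longrightarrow> \<xi> p \<in> X \<and> prefix (\<xi> p) n = fst p
      \<and> prefix ((shift ^^ (n + G)) (\<xi> p)) k = snd p" by metis
  define w where "w p = prefix (\<xi> p) (n + G + k)" for p
  have w1: "take n (w p) = fst p" "drop (n + G) (w p) = snd p" if "p \<in> ?I" for p
    using \<xi>[OF that] take_prefix[of n _ "G + k"] drop_prefix[of "n + G" "\<xi> p" k]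
    by (auto simp: w_def add.assoc)
  have inj: "inj_on w ?I"
    by (rule inj_onI) (metis w1 prod.collapse)
  have wI: "w p \<in> {w. take n w \<in> U \<and> drop (n + G) w \<in> V} \<inter> wo (n + G + k)" if "p \<in> ?I" for p
    using w1[OF that] that \<xi>[OF that] prefix_words[of "\<xi> p" "n + G + k"] by (auto simp: w_def)
  have eq: "{x \<in> cset n U. (shift ^^ (n + G)) x \<in> cset k V}
      = cset (n + G + k) {w. take n w \<in> U \<and> drop (n + G) w \<in> V}"
    using take_prefix[of n _ "G + k"] drop_prefix[of "n + G" _ k] by (auto simp: cset_def shift_X add.assoc)
  have "c1 * measure \<mu> (cset n U) * measure \<mu> (cset k V) = (\<Sum>(u, v)\<in>?I. c1 * m u * m v)"
    unfolding measure_cset by (rule sum_times[symmetric])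
  also have "\<dots> \<le> (\<Sum>p\<in>?I. m (w p))"
  proof (intro sum_mono)
    fix p assume p: "p \<in> ?I"
    show "(case p of (u, v) \<Rightarrow> c1 * m u * m v) \<le> m (w p)"
      using quasi_mult_lower[of "\<xi> p" n k] \<xi>[OF p] by (cases p) (simp add: w_def)
  qed
  also have "\<dots> = (\<Sum>u\<in>w ` ?I. m u)" by (subst sum.reindex[OF inj]) simp
  also have "\<dots> \<le> (\<Sum>u\<in>{w. take n w \<in> U \<and> drop (n + G) w \<in> V} \<inter> wo (n + G + k). m u)"
    using wI finite_words by (intro sum_mono2) auto
  finally show ?thesis by (simp add: eq measure_cset)
qed

section \<open>Density and second moments\<close>

lemma cset_Compl: "X - cset n U = cset n (- U)"
  by (auto simp: cset_def)

lemma cset_Un: "\<exists>k W. cset n U \<union> cset j V = cset k W"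
proof -
  have "cset n U \<union> cset j V = cset (max n j) ({w. take n w \<in> U} \<union> {w. take j w \<in> V})"
    using cset_extend[of n "max n j" U] cset_extend[of j "max n j" V] by (auto simp: cset_def)
  then show ?thesis by blast
qed

definition approximable :: "seq set \<Rightarrow> bool" where
  "approximable E \<longleftrightarrow> (\<forall>\<epsilon>>0. \<exists>n U. measure \<mu> (sym_diff E (cset n U)) < \<epsilon>)"

lemma approximable_Un:
  assumes "D \<in> sets \<mu>" "E \<in> sets \<mu>" "approximable D" "approximable E"
  shows "approximable (D \<union> E)"
  unfolding approximable_def
proof (intro allI impI)
  fix \<epsilon> :: real assume "\<epsilon> > 0"
  then have "\<epsilon> / 2 > 0" by simp
  then obtain n U j V where UV: "measure \<mu> (sym_diff D (cset n U)) < \<epsilon> / 2"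
    "measure \<mu> (sym_diff E (cset j V)) < \<epsilon> / 2"
    using assms unfolding approximable_def by meson
  obtain k W where W: "cset n U \<union> cset j V = cset k W" using cset_Un by blast
  have "measure \<mu> (sym_diff (D \<union> E) (cset k W))
      \<le> measure \<mu> (sym_diff D (cset n U) \<union> sym_diff E (cset j V))"
    unfolding W[symmetric] using assms by (intro finite_measure_mono) auto
  also have "\<dots> \<le> measure \<mu> (sym_diff D (cset n U)) + measure \<mu> (sym_diff E (cset j V))"
    using assms by (intro measure_Un_le) auto
  also have "\<dots> < \<epsilon>" using UV by simp
  finally show "\<exists>n U. measure \<mu> (sym_diff (D \<union> E) (cset n U)) < \<epsilon>" by blast
qed

text \<open>The events of finite depth form an algebra that generates the measurable sets, so the
  sets approximated by them in measure form a sigma-algebra.\<close>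

lemma sets_approximable:
  assumes "E \<in> sets \<mu>"
  shows "approximable E"
  using assms unfolding sets_cyl
proof (induction rule: sigma_sets.induct)
  case (Basic E)
  then obtain w where "E = cset (length w) {w}" using cyl_eq_cset by blast
  then have "sym_diff E (cset (length w) {w}) = {}" by blast
  then show ?case unfolding approximable_def by (metis measure_empty)
next
  case Empty
  have "sym_diff {} (cset 0 {}) = {}" by (simp add: cset_def)
  then show ?case unfolding approximable_def by (metis measure_empty)
next
  case (Compl E)
  have "sym_diff (X - E) (cset n (- U)) = sym_diff E (cset n U)" for n U
    using sigma_sets_into_sp[OF _ Compl.hyps] cset_subset
    by (auto simp: cset_Compl[symmetric] cyl_def)
  with Compl.IH show ?case unfolding approximable_def by metis
next
  case (Union E)
  note meas = Union.hyps[unfolded sets_cyl[symmetric]]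
  have fin: "approximable (\<Union>i<N. E i)" for N
  proof (induction N)
    case 0
    have "sym_diff {} (cset 0 {}) = {}" by (simp add: cset_def)
    then show ?case unfolding approximable_def by (metis SUP_empty lessThan_0 measure_empty)
  next
    case (Suc N)
    then show ?case
      using approximable_Un[of "\<Union>i<N. E i" "E N"] Union.IH meas
      by (simp add: lessThan_Suc Un_commute)
  qed
  show ?case
    unfolding approximable_def
  proof (intro allI impI)
    fix \<epsilon> :: real assume e: "\<epsilon> > 0"
    \<comment> \<open>By continuity from below a finite part of the union has almost its full
      measure, and finite unions are already approximable.\<close>
    have "(\<lambda>N. measure \<mu> (\<Union>i<N. E i)) \<longlonglongrightarrow> measure \<mu> (\<Union>N. \<Union>i<N. E i)"
    proof (rule finite_Lim_measure_incseq)
      show "incseq (\<lambda>N. \<Union>i<N. E i)" by (intro monoI UN_mono) auto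
    qed (use meas in auto)
    moreover have "(\<Union>N. \<Union>i<N. E i) = (\<Union>i. E i)" by auto
    ultimately have "eventually (\<lambda>N. measure \<mu> (\<Union>i<N. E i) > measure \<mu> (\<Union>i. E i) - \<epsilon> / 2) sequentially"
      using e by (intro order_tendstoD(1)) auto
    then obtain N where N: "measure \<mu> (\<Union>i<N. E i) > measure \<mu> (\<Union>i. E i) - \<epsilon> / 2"
      by (auto simp: eventually_sequentially)
    obtain n U where U: "measure \<mu> (sym_diff (\<Union>i<N. E i) (cset n U)) < \<epsilon> / 2"
      using fin[of N] e unfolding approximable_def by (meson half_gt_zero)
    have "sym_diff (\<Union>i. E i) (\<Union>i<N. E i) = (\<Union>i. E i) - (\<Union>i<N. E i)" by auto
    moreover have "measure \<mu> ((\<Union>i. E i) - (\<Union>i<N. E i)) = measure \<mu> (\<Union>i. E i) - measure \<mu> (\<Union>i<N. E i)"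
      using meas by (intro finite_measure_Diff) auto
    ultimately have "measure \<mu> (sym_diff (\<Union>i. E i) (\<Union>i<N. E i)) < \<epsilon> / 2" using N by simp
    with U measure_sym_diff_triangle[of "\<Union>i. E i" "\<Union>i<N. E i" "cset n U"] meas
    have "measure \<mu> (sym_diff (\<Union>i. E i) (cset n U)) < \<epsilon>" by fastforce
    then show "\<exists>n U. measure \<mu> (sym_diff (\<Union>i. E i) (cset n U)) < \<epsilon>" by blast
  qed
qed

text \<open>Takes the place of a density theorem: if the complement E of R had positive measure, a
  good approximation of E by an event of finite depth would meet R in at least a proportion c of
  itself, yet that intersection lies in the approximation error.\<close>

lemma measure_eq_1_if_dense:
  assumes R: "R \<in> sets \<mu>" and c: "c > 0"
    and dense: "\<And>n U. measure \<mu> (R \<inter> cset n U) \<ge> c * measure \<mu> (cset n U)"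
  shows "measure \<mu> R = 1"
proof (rule ccontr)
  assume "measure \<mu> R \<noteq> 1"
  define E where "E = X - R"
  have E: "E \<in> sets \<mu>" using R by (simp add: E_def)
  have "measure \<mu> E = 1 - measure \<mu> R"
    using prob_compl[OF R] by (simp add: E_def space_mu)
  moreover have "measure \<mu> R \<le> 1" by simp
  ultimately have pos: "measure \<mu> E > 0" using \<open>measure \<mu> R \<noteq> 1\<close> by linarith
  \<comment> \<open>Solves \<epsilon> = c (\<mu>(E) - \<epsilon>), where \<mu>(E) - \<epsilon>
    bounds the measure of the approximating event from below.\<close>
  define \<epsilon> where "\<epsilon> = c * measure \<mu> E / (1 + c)"
  have "\<epsilon> > 0" using pos c by (simp add: \<epsilon>_def)
  then obtain n U where U: "measure \<mu> (sym_diff E (cset n U)) < \<epsilon>"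
    using sets_approximable[OF E] unfolding approximable_def by blast
  have "measure \<mu> (R \<inter> cset n U) \<le> measure \<mu> (sym_diff E (cset n U))"
    using E by (intro finite_measure_mono) (auto simp: E_def)
  with dense[of n U] U have 1: "c * measure \<mu> (cset n U) < \<epsilon>" by linarith
  have "measure \<mu> E \<le> measure \<mu> (cset n U \<union> sym_diff E (cset n U))"
    using E by (intro finite_measure_mono) auto
  also have "\<dots> \<le> measure \<mu> (cset n U) + measure \<mu> (sym_diff E (cset n U))"
    using E by (intro measure_Un_le) auto
  finally have "measure \<mu> E < measure \<mu> (cset n U) + \<epsilon>" using U by simp
  then have "c * measure \<mu> E < c * (measure \<mu> (cset n U) + \<epsilon>)" using c by simp
  also have "\<dots> < \<epsilon> + c * \<epsilon>" using 1 by (simp add: distrib_left)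
  also have "\<dots> = \<epsilon> * (1 + c)" by (simp add: algebra_simps)
  also have "\<dots> = c * measure \<mu> E" using c by (simp add: \<epsilon>_def)
  finally show False by simp
qed

text \<open>With G free symbols any symbol can occur at position n + G after the given n symbols. A
  symbol different from \<open>x (n + G)\<close> takes at least a proportion c away from the
  cylinder.\<close>

lemma cylinder_shrink:
  "\<exists>c>0. \<forall>x\<in>X. \<forall>n. m (prefix x (n + Suc G)) \<le> (1 - c) * m (prefix x n)"
proof -
  have wo1: "[a] \<in> wo 1" if "a \<in> {1, 2}" for a
    using that K2 by (auto simp: words_def)
  \<comment> \<open>K \<ge> 2 provides the symbols 1 and 2, one of which differs from
    \<open>x (n + G)\<close>.\<close>
  define c where "c = c1 * min (m [1]) (m [2])"
  have "c > 0" using c1_pos m_pos[OF wo1[of 1]] m_pos[OF wo1[of 2]] by (simp add: c_def)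
  moreover have "m (prefix x (n + Suc G)) \<le> (1 - c) * m (prefix x n)" if x: "x \<in> X" for x n
  proof -
    define a where "a = (if x (n + G) = 1 then 2 else 1 :: nat)"
    have a: "a \<in> {1, 2}" "a \<noteq> x (n + G)" by (auto simp: a_def)
    obtain z where z: "z \<in> X" "prefix z 1 = [a]" using words_extend[OF wo1[OF a(1)]] by metis
    obtain y where y: "y \<in> X" "prefix y n = prefix x n" "(shift ^^ (n + G)) y = z"
      using connect[OF prefix_words[OF x] z(1)] by metis
    have "y (n + G) = z 0" using y(3) shift_pow[of "n + G" y 0] by simp
    moreover have "z 0 = a" using z(2) nth_prefix[of 0 1 z] by simp
    ultimately have ya: "y (n + G) = a" by simp
    have "c * m (prefix x n) \<le> c1 * m (prefix y n) * m [a]"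
    proof -
      have "min (m [1]) (m [2]) * (c1 * m (prefix x n)) \<le> m [a] * (c1 * m (prefix x n))"
        using a(1) c1_pos by (intro mult_right_mono) auto
      then show ?thesis unfolding c_def y(2) by (simp add: ac_simps)
    qed
    also have "\<dots> \<le> m (prefix y (n + G + 1))"
      using quasi_mult_lower[OF y(1), of n 1] y(3) z(2) by simp
    finally have 1: "c * m (prefix x n) \<le> m (prefix y (n + Suc G))" by simp
    have "m (prefix x (n + Suc G)) + m (prefix y (n + Suc G))
        = measure \<mu> (cy (prefix x (n + Suc G)) \<union> cy (prefix y (n + Suc G)))"
    proof (rule finite_measure_Union[symmetric])
      have "n + G < n + Suc G" by simp
      then show "cy (prefix x (n + Suc G)) \<inter> cy (prefix y (n + Suc G)) = {}"
        using a(2) ya unfolding cyl_prefix by fastforce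
    qed auto
    also have "\<dots> \<le> m (prefix x n)"
    proof (intro finite_measure_mono Un_least)
      show "cy (prefix x (n + Suc G)) \<subseteq> cy (prefix x n)" by (auto simp: cyl_prefix)
      show "cy (prefix y (n + Suc G)) \<subseteq> cy (prefix x n)"
        unfolding y(2)[symmetric] by (auto simp: cyl_prefix)
    qed simp
    finally show ?thesis using 1 by (simp add: algebra_simps)
  qed
  ultimately show ?thesis by blast
qed

text \<open>The sum T satisfies T \<le> Suc G + (1 - c) T: the first \<open>Suc G\<close> terms are
  at most 1, and the others are compared with the terms \<open>Suc G\<close> places earlier.\<close>

lemma sum_cylinders_bounded: "\<exists>Q>0. \<forall>x\<in>X. \<forall>n. (\<Sum>r<n. m (prefix x r)) \<le> Q"
proof -
  obtain c where c: "c > 0" "\<And>x n. x \<in> X \<Longrightarrow> m (prefix x (n + Suc G)) \<le> (1 - c) * m (prefix x n)"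
    using cylinder_shrink by blast
  have "(\<Sum>r<n. m (prefix x r)) \<le> real (Suc G) / c" if x: "x \<in> X" for x n
  proof -
    let ?T = "\<Sum>r<n. m (prefix x r)"
    have "?T \<le> (\<Sum>r<Suc G + n. m (prefix x r))" by (intro sum_mono2) auto
    also have "\<dots> = (\<Sum>r<Suc G. m (prefix x r)) + (\<Sum>r<n. m (prefix x (r + Suc G)))"
      by (induction n) (simp_all add: add.commute del: sum.lessThan_Suc, simp add: add.commute)
    also have "\<dots> \<le> (\<Sum>r<Suc G. 1) + (\<Sum>r<n. (1 - c) * m (prefix x r))"
      by (intro add_mono sum_mono c(2) x) simp
    also have "\<dots> = real (Suc G) + (1 - c) * ?T" by (simp add: sum_distrib_left)
    finally show ?thesis using c(1) by (simp add: field_simps)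
  qed
  moreover have "real (Suc G) / c > 0" using c(1) by simp
  ultimately show ?thesis by blast
qed

section \<open>Returns of a word to itself\<close>

definition hits :: "nat list \<Rightarrow> nat \<Rightarrow> seq set" where
  "hits w p = {y \<in> cy w. (shift ^^ p) y \<in> cy w}"

lemma cset_take: "n \<le> p \<Longrightarrow> length w = n \<Longrightarrow> cy w = cset p {v. take n v = w}"
  using cset_extend[of n p "{w}"] by (simp add: cyl_eq_cset)

lemma meas_hits [measurable]: "hits w p \<in> sets \<mu>"
proof -
  have "hits w p = cy w \<inter> ((shift ^^ p) -` cy w \<inter> space \<mu>)"
    by (auto simp: hits_def cyl_def space_mu)
  then show ?thesis using measurable_sets[OF shift_pow_meas meas_cy] by simp
qed

text \<open>Read w as an event of depth p - G; then the gap ends exactly at time p.\<close>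

lemma measure_hits_lower:
  assumes "w \<in> wo n" "p \<ge> n + G"
  shows "c1 * (m w)\<^sup>2 \<le> measure \<mu> (hits w p)"
proof -
  have l: "length w = n" using assms(1) by (simp add: words_def)
  have 1: "cy w = cset (p - G) {v. take n v = w}" using assms l by (intro cset_take) auto
  have "hits w p = {y \<in> cset (p - G) {v. take n v = w}. (shift ^^ (p - G + G)) y \<in> cset n {w}}"
    using assms(2) 1 cyl_eq_cset[OF l] by (simp add: hits_def)
  then show ?thesis
    using quasi_indep_lower[of "p - G" "{v. take n v = w}" n "{w}"] 1 cyl_eq_cset[OF l]
    by (simp add: power2_eq_square mult.assoc)
qed

text \<open>For r < n the two copies of w overlap, and the event only forces \<open>take r w\<close>
  followed by w, which yields the factor \<open>m (take r w)\<close>. For r \<ge> n the copies are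
  disjoint and the factor is \<open>m w\<close>.\<close>

lemma measure_hits_upper:
  assumes "w \<in> wo n"
  shows "measure \<mu> (hits w r) \<le> C ^ 3 * m w * (m w + (if r < n then m (take r w) else 0))"
proof (cases "r < n")
  case True
  have l: "length w = n" using assms(1) by (simp add: words_def)
  have lt: "length (take r w) = r" using True l by simp
  have "hits w r \<subseteq> {y \<in> cset r {take r w}. (shift ^^ r) y \<in> cset n {w}}"
    using l True unfolding cyl_eq_cset[OF lt, symmetric] cyl_eq_cset[OF l, symmetric]
    by (auto simp: hits_def cyl_def)
  then have "measure \<mu> (hits w r) \<le> measure \<mu> {y \<in> cset r {take r w}. (shift ^^ r) y \<in> cset n {w}}"
    by (intro finite_measure_mono) (simp_all add: cset_shift)
  also have "\<dots> \<le> C ^ 3 * m (take r w) * m w"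
    using quasi_indep_upper[of r "{take r w}" n "{w}"] cyl_eq_cset[OF l] cyl_eq_cset[OF lt] by simp
  also have "\<dots> \<le> C ^ 3 * m w * (m w + m (take r w))"
    using C by (simp add: algebra_simps)
  finally show ?thesis using True by simp
next
  case False
  have l: "length w = n" using assms(1) by (simp add: words_def)
  have 1: "cy w = cset r {v. take n v = w}" using False l by (intro cset_take) auto
  have "hits w r = {y \<in> cset r {v. take n v = w}. (shift ^^ r) y \<in> cset n {w}}"
    using 1 cyl_eq_cset[OF l] by (simp add: hits_def)
  then show ?thesis
    using quasi_indep_upper[of r "{v. take n v = w}" n "{w}"] 1 cyl_eq_cset[OF l] False by simp
qed

text \<open>Since p \<ge> n, the copy at time 0 is over before time p, and after p steps the other
  two copies say that the orbit is in \<open>hits w (q - p)\<close>. Two uses of quasi-independence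
  give C ^ 6.\<close>

lemma measure_hits_pair:
  assumes "w \<in> wo n" "n \<le> p" "p \<le> q"
  shows "measure \<mu> (hits w p \<inter> hits w q)
     \<le> C ^ 6 * (m w)\<^sup>2 * (m w + (if q - p < n then m (take (q - p) w) else 0))"
proof -
  have l: "length w = n" using assms(1) by (simp add: words_def)
  let ?r = "q - p"
  have 1: "cy w = cset p {v. take n v = w}" using assms l by (intro cset_take) auto
  have "hits w ?r = cset (?r + n) {u. take n u = w \<and> drop ?r u = w}"
    using l take_prefix_le[of n "?r + n"] drop_prefix[of ?r _ n]
    by (auto simp: hits_def cyl_eq_cset[OF l] cset_def shift_X)
  note 2 = this
  have "hits w p \<inter> hits w q = {y \<in> cset p {v. take n v = w}. (shift ^^ p) y \<in> hits w ?r}"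
    using assms(3) unfolding 1[symmetric] by (auto simp: hits_def shift_pow_add)
  then have "measure \<mu> (hits w p \<inter> hits w q) \<le> C ^ 3 * m w * measure \<mu> (hits w ?r)"
    using quasi_indep_upper[of p "{v. take n v = w}"] 1 2 by simp
  also have "\<dots> \<le> C ^ 3 * m w * (C ^ 3 * m w * (m w + (if ?r < n then m (take ?r w) else 0)))"
    using C by (intro mult_left_mono measure_hits_upper assms) auto
  also have "\<dots> = C ^ 6 * (m w)\<^sup>2 * (m w + (if ?r < n then m (take ?r w) else 0))"
    by (simp add: power2_eq_square power_add[of C 3 3, simplified] algebra_simps)
  finally show ?thesis .
qed

text \<open>For fixed p each gap |q - p| occurs at most once on either side of p. The overlap terms
  are measures of cylinders around one point, so they sum to at most Q on each side.\<close>

lemma sum_hits_pairs: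
  assumes w: "w \<in> wo n" and T: "finite T" "\<And>p. p \<in> T \<Longrightarrow> p \<ge> n"
    and Q: "\<And>x n. x \<in> X \<Longrightarrow> (\<Sum>r<n. m (prefix x r)) \<le> Q"
  shows "(\<Sum>p\<in>T. \<Sum>q\<in>T. measure \<mu> (hits w p \<inter> hits w q))
      \<le> C ^ 6 * (m w)\<^sup>2 * real (card T) * (real (card T) * m w + 2 * Q)"
proof -
  let ?g = "\<lambda>r. if r < n then m (take r w) else 0"
  obtain x where x: "x \<in> X" "prefix x n = w" using words_extend[OF w] by metis
  have "(\<Sum>r<n. m (take r w)) = (\<Sum>r<n. m (prefix x r))"
    using x(2) by (intro sum.cong) (auto simp: take_prefix_le less_imp_le)
  then have gQ: "(\<Sum>r<n. m (take r w)) \<le> Q" using Q[OF x(1), of n] by simp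
  have C0: "C > 0" using C by simp
  have "(\<Sum>q\<in>T. measure \<mu> (hits w p \<inter> hits w q)) \<le> C ^ 6 * (m w)\<^sup>2 * (real (card T) * m w + 2 * Q)"
    if p: "p \<in> T" for p
  proof -
    \<comment> \<open>The diagonal q = p falls under the first case with gap 0.\<close>
    have "(\<Sum>q\<in>T. measure \<mu> (hits w p \<inter> hits w q))
        \<le> (\<Sum>q\<in>T. C ^ 6 * (m w)\<^sup>2 * (m w + ((if p \<le> q then ?g (q - p) else 0) + (if q < p then ?g (p - q) else 0))))"
    proof (intro sum_mono)
      fix q assume q: "q \<in> T"
      show "measure \<mu> (hits w p \<inter> hits w q)
        \<le> C ^ 6 * (m w)\<^sup>2 * (m w + ((if p \<le> q then ?g (q - p) else 0) + (if q < p then ?g (p - q) else 0)))"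
      proof (cases "p \<le> q")
        case True
        then show ?thesis using measure_hits_pair[OF w T(2)[OF p] True] by simp
      next
        case False
        then have "q \<le> p" by simp
        from measure_hits_pair[OF w T(2)[OF q] this] False show ?thesis by (simp add: Int_commute)
      qed
    qed
    also have "\<dots> = C ^ 6 * (m w)\<^sup>2 * (real (card T) * m w
        + ((\<Sum>q\<in>T. if p \<le> q then ?g (q - p) else 0) + (\<Sum>q\<in>T. if q < p then ?g (p - q) else 0)))"
      unfolding sum_distrib_left[symmetric] sum.distrib by simp
    also have "\<dots> \<le> C ^ 6 * (m w)\<^sup>2 * (real (card T) * m w + (Q + Q))"
    proof (intro mult_left_mono add_mono order_refl)
      have "(\<Sum>q\<in>T. if p \<le> q then ?g (q - p) else 0) = (\<Sum>q\<in>{q\<in>T. p \<le> q}. ?g (q - p))"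
        using T(1) by (simp add: sum.inter_filter)
      also have "\<dots> \<le> (\<Sum>r<n. m (take r w))"
        using T(1) by (intro sum_card_shifted_le) (auto simp: inj_on_def)
      finally show "(\<Sum>q\<in>T. if p \<le> q then ?g (q - p) else 0) \<le> Q" using gQ by simp
      have "(\<Sum>q\<in>T. if q < p then ?g (p - q) else 0) = (\<Sum>q\<in>{q\<in>T. q < p}. ?g (p - q))"
        using T(1) by (simp add: sum.inter_filter)
      also have "\<dots> \<le> (\<Sum>r<n. m (take r w))"
        using T(1) by (intro sum_card_shifted_le) (auto simp: inj_on_def)
      finally show "(\<Sum>q\<in>T. if q < p then ?g (p - q) else 0) \<le> Q" using gQ by simp
    qed (use C0 in auto)
    finally show ?thesis by simp
  qed
  then have "(\<Sum>p\<in>T. \<Sum>q\<in>T. measure \<mu> (hits w p \<inter> hits w q))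
      \<le> (\<Sum>p\<in>T. C ^ 6 * (m w)\<^sup>2 * (real (card T) * m w + 2 * Q))"
    by (intro sum_mono)
  then show ?thesis by (simp add: mult_ac)
qed

text \<open>Second moment method with a = \<open>card T * m w\<close> \<ge> 1: the first moment is
  at least c1 a m(w), the second at most D a^2 m(w).\<close>

lemma return_probability:
  "\<exists>c>0. \<forall>n w T. w \<in> wo n \<longrightarrow> finite T \<longrightarrow> (\<forall>p\<in>T. p \<ge> n + G) \<longrightarrow> real (card T) * m w \<ge> 1 \<longrightarrow>
     measure \<mu> (\<Union>p\<in>T. hits w p) \<ge> c * m w"
proof -
  obtain Q where Q: "Q > 0" "\<And>x n. x \<in> X \<Longrightarrow> (\<Sum>r<n. m (prefix x r)) \<le> Q"
    using sum_cylinders_bounded by blast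
  define D where "D = C ^ 6 * (1 + 2 * Q)"
  have D: "D > 0" using C Q(1) by (simp add: D_def)
  have "measure \<mu> (\<Union>p\<in>T. hits w p) \<ge> c1\<^sup>2 / D * m w"
    if w: "w \<in> wo n" and T: "finite T" "\<forall>p\<in>T. p \<ge> n + G" and a1: "real (card T) * m w \<ge> 1" for n w T
  proof -
    define a where "a = real (card T) * m w"
    \<comment> \<open>This t maximises 2 t c1 a - t^2 D a^2; the maximum c1^2 / D is free of
      a.\<close>
    define t where "t = c1 / (D * a)"
    have a: "a \<ge> 1" using a1 by (simp add: a_def)
    have t: "t \<ge> 0" using c1_pos D a by (simp add: t_def)
    have "(\<Sum>p\<in>T. measure \<mu> (hits w p)) \<ge> (\<Sum>p\<in>T. c1 * (m w)\<^sup>2)"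
      using T(2) by (intro sum_mono measure_hits_lower[OF w]) auto
    then have E1: "(\<Sum>p\<in>T. measure \<mu> (hits w p)) \<ge> c1 * a * m w"
      by (simp add: a_def power2_eq_square mult_ac)
    have "(\<Sum>p\<in>T. \<Sum>q\<in>T. measure \<mu> (hits w p \<inter> hits w q))
        \<le> C ^ 6 * (m w)\<^sup>2 * real (card T) * (real (card T) * m w + 2 * Q)"
      using T(2) by (intro sum_hits_pairs[OF w T(1) _ Q(2)]) auto
    also have "\<dots> = C ^ 6 * m w * a * (a + 2 * Q)" by (simp add: a_def power2_eq_square mult_ac)
    \<comment> \<open>Here a \<ge> 1 enters, in the form a + 2 Q \<le> a (1 + 2 Q).\<close>
    also have "\<dots> \<le> C ^ 6 * m w * a * (a * (1 + 2 * Q))"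
      using a C Q(1) mult_right_mono[OF a, of "2 * Q"] by (intro mult_left_mono) (auto simp: algebra_simps)
    also have "\<dots> = D * a\<^sup>2 * m w" by (simp add: D_def power2_eq_square mult_ac)
    finally have E2: "(\<Sum>p\<in>T. \<Sum>q\<in>T. measure \<mu> (hits w p \<inter> hits w q)) \<le> D * a\<^sup>2 * m w" .
    have "c1\<^sup>2 / D * m w = 2 * t * (c1 * a * m w) - t\<^sup>2 * (D * a\<^sup>2 * m w)"
      using a D by (simp add: t_def power2_eq_square field_simps)
    also have "\<dots> \<le> 2 * t * (\<Sum>p\<in>T. measure \<mu> (hits w p))
        - t\<^sup>2 * (\<Sum>p\<in>T. \<Sum>q\<in>T. measure \<mu> (hits w p \<inter> hits w q))"
      using t E1 E2 by (intro diff_mono mult_left_mono) auto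
    also have "\<dots> \<le> measure \<mu> (\<Union>p\<in>T. hits w p)"
      by (intro second_moment T(1)) simp
    finally show ?thesis .
  qed
  moreover have "c1\<^sup>2 / D > 0" using c1_pos D by simp
  ultimately show ?thesis by blast
qed

section \<open>Returns along a sequence of depths\<close>

definition returns :: "nat \<Rightarrow> nat set \<Rightarrow> seq set" where
  "returns n T = {x \<in> X. \<exists>p\<in>T. \<forall>j<n. x (p + j) = x j}"

lemma meas_returns [measurable]: "returns n T \<in> sets \<mu>"
proof -
  have "returns n T = (\<Union>p\<in>T. cset (p + n) {w. \<forall>j<n. w ! (p + j) = w ! j})"
    by (auto simp: returns_def cset_def)
  also have "\<dots> \<in> sets \<mu>" by (intro sets.countable_UN') auto
  finally show ?thesis .
qed

lemma hits_subset_returns: "length w = n \<Longrightarrow> p \<in> T \<Longrightarrow> hits w p \<subseteq> returns n T"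
  unfolding hits_def returns_def cyl_def by (auto simp: shift_pow intro!: bexI[of _ p])

text \<open>At most G of the times are smaller than n + G. Dropping them costs at most G in
  \<open>card T * m w\<close>, since m(w) \<le> 1; hence the bound 1 + G. Distinct words have
  disjoint cylinders, so the estimates for single words add up.\<close>

lemma returns_in_cset:
  assumes c: "\<forall>n w T. w \<in> wo n \<longrightarrow> finite T \<longrightarrow> (\<forall>p\<in>T. p \<ge> n + G) \<longrightarrow> real (card T) * m w \<ge> 1 \<longrightarrow>
     measure \<mu> (\<Union>p\<in>T. hits w p) \<ge> c * m w"
    and T: "finite T" "\<forall>p\<in>T. p \<ge> n"
    and W: "\<And>w. w \<in> W \<Longrightarrow> w \<in> wo n \<Longrightarrow> real (card T) * m w \<ge> 1 + real G"
  shows "measure \<mu> (cset n W \<inter> returns n T) \<ge> c * measure \<mu> (cset n W)"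
proof -
  let ?T = "{p\<in>T. p \<ge> n + G}"
  have cardT: "real (card T) \<le> real (card ?T) + real G"
  proof -
    have "T \<subseteq> ?T \<union> {n..<n+G}" using T(2) by auto
    then have "card T \<le> card (?T \<union> {n..<n+G})" using T(1) by (intro card_mono) auto
    also have "\<dots> \<le> card ?T + card {n..<n+G}" by (rule card_Un_le)
    finally show ?thesis by simp
  qed
  have w: "c * m w \<le> measure \<mu> (cy w \<inter> returns n T)" if "w \<in> W \<inter> wo n" for w
  proof -
    have "real (card T) * m w \<le> (real (card ?T) + real G) * m w"
      using cardT by (intro mult_right_mono) auto
    also have "\<dots> \<le> real (card ?T) * m w + real G * 1"
      unfolding distrib_right by (intro add_mono mult_left_mono) auto
    finally have "real (card ?T) * m w \<ge> 1" using W[of w] that by simp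
    then have "c * m w \<le> measure \<mu> (\<Union>p\<in>?T. hits w p)" using that T(1) by (intro c[rule_format, of w n]) auto
    also have "\<dots> \<le> measure \<mu> (cy w \<inter> returns n T)"
      using that hits_subset_returns[of w n _ T]
      by (intro finite_measure_mono) (auto simp: words_def hits_def)
    finally show ?thesis .
  qed
  have "c * measure \<mu> (cset n W) = (\<Sum>w\<in>W \<inter> wo n. c * m w)"
    by (simp add: measure_cset sum_distrib_left)
  also have "\<dots> \<le> (\<Sum>w\<in>W \<inter> wo n. measure \<mu> (cy w \<inter> returns n T))" by (rule sum_mono) (rule w)
  also have "\<dots> = measure \<mu> (\<Union>w\<in>W \<inter> wo n. cy w \<inter> returns n T)"
  proof (rule finite_measure_finite_Union[symmetric])
    show "disjoint_family_on (\<lambda>w. cy w \<inter> returns n T) (W \<inter> wo n)"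
      by (auto simp: disjoint_family_on_def cyl_def words_def list_eq_iff_nth_eq)
  qed (use finite_words in auto)
  also have "(\<Union>w\<in>W \<inter> wo n. cy w \<inter> returns n T) = cset n W \<inter> returns n T"
    by (auto simp: cset_UN)
  finally show ?thesis .
qed

text \<open>Stop at the first level k \<ge> k0 at which the prefix belongs to W k: the pieces of
  this decomposition are disjoint, and a fixed proportion of each returns. The bound c c0 is
  independent of k0 and of the event, so the density criterion applies to the limsup set.\<close>

lemma returns_infinitely_often:
  fixes nk :: "nat \<Rightarrow> nat" and T :: "nat \<Rightarrow> nat set" and W :: "nat \<Rightarrow> nat list set"
  assumes nk: "strict_mono nk" and fin: "\<And>k. finite (T k)"
    and T: "eventually (\<lambda>k. \<forall>p\<in>T k. p \<ge> nk k) sequentially"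
    and W: "\<And>k w. w \<in> W k \<Longrightarrow> w \<in> wo (nk k) \<Longrightarrow> real (card (T k)) * m w \<ge> 1 + real G"
    and c0: "c0 > 0"
    and dense: "\<And>j U k0. measure \<mu> (cset j U \<inter> (\<Union>k\<in>{k0..}. cset (nk k) (W k))) \<ge> c0 * measure \<mu> (cset j U)"
  shows "measure \<mu> {x \<in> X. infinite {k. x \<in> returns (nk k) (T k)}} = 1"
proof -
  obtain c where c: "c > 0" "\<forall>n w T. w \<in> wo n \<longrightarrow> finite T \<longrightarrow> (\<forall>p\<in>T. p \<ge> n + G) \<longrightarrow>
      real (card T) * m w \<ge> 1 \<longrightarrow> measure \<mu> (\<Union>p\<in>T. hits w p) \<ge> c * m w"
    using return_probability by blast
  obtain k1 where k1: "\<And>k p. k \<ge> k1 \<Longrightarrow> p \<in> T k \<Longrightarrow> p \<ge> nk k"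
    using T by (auto simp: eventually_sequentially)
  let ?R = "\<lambda>k. returns (nk k) (T k)"
  have step: "measure \<mu> (cset j U \<inter> (\<Union>k\<in>{k0..}. ?R k)) \<ge> c * (c0 * measure \<mu> (cset j U))"
    if k0: "k0 \<ge> k1" "k0 \<ge> j" for j U k0
  proof -
    define B where "B i = cset j U \<inter> cset (nk (k0 + i)) (W (k0 + i))" for i
    have ge: "j \<le> nk (k0 + i)" for i
      using strict_mono_imp_increasing[OF nk, of "k0 + i"] k0 by linarith
    \<comment> \<open>The piece of level k0 + i is itself an event of depth nk (k0 + i): the earlier
      levels and U need only shorter prefixes.\<close>
    have "\<exists>V. cset (nk (k0 + i)) V = disjointed B i \<and> V \<subseteq> W (k0 + i)" for i
    proof -
      have le: "nk (k0 + l) \<le> nk (k0 + i)" if "l < i" for l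
        using that nk by (simp add: strict_mono_less_eq)
      let ?n = "nk (k0 + i)"
      let ?V = "{w. take j w \<in> U \<and> w \<in> W (k0 + i) \<and>
          (\<forall>l<i. \<not> (take j w \<in> U \<and> take (nk (k0 + l)) w \<in> W (k0 + l)))}"
      have "cset ?n ?V = disjointed B i"
        using le by (auto simp: disjointed_def B_def cset_def take_prefix_le ge)
      then show ?thesis by blast
    qed
    then obtain V where V: "\<And>i. cset (nk (k0 + i)) (V i) = disjointed B i" "\<And>i. V i \<subseteq> W (k0 + i)"
      by metis
    have Bm: "range B \<subseteq> sets \<mu>" by (auto simp: B_def)
    have dB: "disjointed B i \<in> sets \<mu>" for i
      using V(1)[of i, symmetric] by simp
    have s1: "(\<lambda>i. measure \<mu> (disjointed B i)) sums measure \<mu> (\<Union>i. disjointed B i)"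
      using dB by (intro finite_measure_UNION disjoint_family_disjointed) auto
    have s2: "(\<lambda>i. measure \<mu> (disjointed B i \<inter> ?R (k0 + i))) sums
        measure \<mu> (\<Union>i. disjointed B i \<inter> ?R (k0 + i))"
    proof (rule finite_measure_UNION)
      show "disjoint_family (\<lambda>i. disjointed B i \<inter> ?R (k0 + i))"
        using disjoint_family_disjointed[of B] by (auto simp: disjoint_family_on_def)
    qed (use dB in auto)
    have le: "c * measure \<mu> (disjointed B i) \<le> measure \<mu> (disjointed B i \<inter> ?R (k0 + i))" for i
      unfolding V(1)[symmetric]
    proof (rule returns_in_cset[OF c(2)])
      show "\<forall>p\<in>T (k0 + i). nk (k0 + i) \<le> p" using k1 k0 by auto
      show "1 + real G \<le> real (card (T (k0 + i))) * m w" if "w \<in> V i" "w \<in> wo (nk (k0 + i))" for w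
        using V(2) that by (intro W) auto
    qed (rule fin)
    have "(\<Union>i. B i) = cset j U \<inter> (\<Union>k\<in>{k0..}. cset (nk k) (W k))"
    proof -
      have "(\<Union>k\<in>{k0..}. H k) = (\<Union>i. H (k0 + i))" for H :: "nat \<Rightarrow> seq set"
        by (auto simp: Bex_def; metis le_Suc_ex le_add1)
      then show ?thesis by (auto simp: B_def)
    qed
    then have "c0 * measure \<mu> (cset j U) \<le> measure \<mu> (\<Union>i. disjointed B i)"
      using dense[of j U] by (simp add: UN_disjointed_eq)
    then have "c * (c0 * measure \<mu> (cset j U)) \<le> c * measure \<mu> (\<Union>i. disjointed B i)"
      using c(1) by simp
    also have "\<dots> \<le> measure \<mu> (\<Union>i. disjointed B i \<inter> ?R (k0 + i))"
      by (rule sums_le[OF le sums_mult[OF s1] s2])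
    also have "\<dots> \<le> measure \<mu> (cset j U \<inter> (\<Union>k\<in>{k0..}. ?R k))"
      using disjointed_subset[of B] by (intro finite_measure_mono) (fastforce simp: B_def)+
    finally show ?thesis .
  qed
  define R where "R = (\<Inter>k0. \<Union>k\<in>{k0..}. ?R k)"
  have R: "R \<in> sets \<mu>" by (simp add: R_def)
  have "measure \<mu> (R \<inter> cset j U) \<ge> (c * c0) * measure \<mu> (cset j U)" for j U
  proof -
    let ?A = "\<lambda>k0. cset j U \<inter> (\<Union>k\<in>{k0..}. ?R k)"
    \<comment> \<open>Continuity from above lets k0 tend to infinity.\<close>
    have "(\<lambda>k0. measure \<mu> (?A k0)) \<longlonglongrightarrow> measure \<mu> (\<Inter>k0. ?A k0)"
    proof (rule finite_Lim_measure_decseq)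
      show "decseq ?A" by (intro antimonoI Int_mono UN_mono) auto
    qed auto
    moreover have "(\<Inter>k0. ?A k0) = R \<inter> cset j U" by (auto simp: R_def)
    ultimately have "(\<lambda>k0. measure \<mu> (?A k0)) \<longlonglongrightarrow> measure \<mu> (R \<inter> cset j U)" by simp
    moreover have "eventually (\<lambda>k0. c * c0 * measure \<mu> (cset j U) \<le> measure \<mu> (?A k0)) sequentially"
      using step[of _ j U] by (intro eventually_sequentiallyI[of "max k1 j"]) (simp add: mult.assoc)
    ultimately show ?thesis by (rule tendsto_lowerbound) simp
  qed
  then have "measure \<mu> R = 1"
    using c(1) c0 by (intro measure_eq_1_if_dense[OF R, of "c * c0"]) auto
  also have "R = {x \<in> X. infinite {k. x \<in> ?R k}}"
  proof -
    have "x \<in> R \<longleftrightarrow> (\<forall>k0. \<exists>k\<ge>k0. x \<in> ?R k)" for x by (simp add: R_def Bex_def)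
    moreover have "x \<in> X" if "x \<in> ?R k" for x k using that by (simp add: returns_def)
    ultimately show ?thesis unfolding infinite_nat_iff_unbounded_le by auto
  qed
  finally show ?thesis .
qed

section \<open>Transfer operators and linear variance\<close>

definition Pre :: "nat \<Rightarrow> seq \<Rightarrow> seq set" where
  "Pre n x = {y \<in> X. (shift ^^ n) y = x}"

lemma PreD: "y \<in> Pre n x \<Longrightarrow> y \<in> X" "y \<in> Pre n x \<Longrightarrow> (shift ^^ n) y = x"
  by (auto simp: Pre_def)

lemma Pre_nth: "y \<in> Pre n x \<Longrightarrow> y (n + j) = x j"
  using shift_pow[of n y j] by (simp add: Pre_def)

lemma Pre_eqI:
  assumes "y \<in> Pre n x" "z \<in> Pre n x" "\<And>j. j < n \<Longrightarrow> y j = z j"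
  shows "y = z"
proof
  fix j
  show "y j = z j"
    using assms Pre_nth[of y n x "j - n"] Pre_nth[of z n x "j - n"] by (cases "j < n") auto
qed

lemma inj_on_prefix_Pre: "inj_on (\<lambda>y. prefix y n) (Pre n x)"
  by (auto intro!: inj_onI Pre_eqI simp: prefix_eq_iff)

lemma finite_Pre [simp]: "finite (Pre n x)"
proof (rule finite_imageD[OF _ inj_on_prefix_Pre])
  show "finite ((\<lambda>y. prefix y n) ` Pre n x)"
    using finite_words by (rule finite_subset[rotated]) (auto intro: prefix_words PreD)
qed

lemma sum_Pre_add:
  "(\<Sum>y\<in>Pre (n + q) x. h y) = (\<Sum>z\<in>Pre q x. \<Sum>y\<in>Pre n z. h y)"
proof -
  have "Pre (n + q) x = (\<Union>z\<in>Pre q x. Pre n z)"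
    by (auto simp: Pre_def shift_X shift_pow_add add.commute)
  moreover have "Pre n z \<inter> Pre n z' = {}" if "z \<noteq> z'" for z z'
    using that by (auto simp: Pre_def)
  ultimately show ?thesis by (simp add: sum.UNION_disjoint)
qed

text \<open>The n-th iterate of Ruelle's transfer operator with potential f, applied to the constant
  1.\<close>

definition lw :: "nat \<Rightarrow> seq \<Rightarrow> real" where
  "lw n x = (\<Sum>y\<in>Pre n x. exp (S n y))"

text \<open>Group the preimages y of order n + q by z = \<sigma>^n y, a preimage of order q.\<close>

lemma lw_add: "lw (n + q) x = (\<Sum>z\<in>Pre q x. exp (S q z) * lw n z)"
  unfolding lw_def sum_Pre_add
  by (intro sum.cong refl) (simp add: birkhoff_add exp_add sum_distrib_left PreD mult.commute)

text \<open>Preimages of x of order n have different prefixes of length n, so the measures of their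
  cylinders sum to at most 1.\<close>

lemma lw_upper: "lw n x \<le> C * exp (real n * P)"
proof -
  have "lw n x \<le> (\<Sum>y\<in>Pre n x. C * exp (real n * P) * m (prefix y n))"
    unfolding lw_def
  proof (intro sum_mono)
    fix y assume "y \<in> Pre n x"
    from gibbs_lower[OF PreD(1)[OF this], of n]
    show "exp (S n y) \<le> C * exp (real n * P) * m (prefix y n)"
      by (simp add: exp_diff field_simps)
  qed
  also have "\<dots> = C * exp (real n * P) * (\<Sum>w\<in>(\<lambda>y. prefix y n) ` Pre n x. m w)"
    by (simp add: sum.reindex[OF inj_on_prefix_Pre] sum_distrib_left)
  also have "\<dots> \<le> C * exp (real n * P) * (\<Sum>w\<in>wo n. m w)"
    using C finite_words by (intro mult_left_mono sum_mono2) (auto intro: prefix_words PreD)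
  finally show ?thesis by (simp add: sum_words)
qed

lemma choose_preimages:
  assumes "x \<in> X"
  obtains \<eta> where "\<And>w. w \<in> wo n \<Longrightarrow> \<eta> w \<in> Pre (n + G) x" "\<And>w. w \<in> wo n \<Longrightarrow> prefix (\<eta> w) n = w"
proof -
  have "\<exists>y. y \<in> Pre (n + G) x \<and> prefix y n = w" if "w \<in> wo n" for w
    using connect[OF that assms] unfolding Pre_def by blast
  then show ?thesis using that by metis
qed

lemma choose_words:
  obtains \<rho> where "\<And>w. w \<in> wo n \<Longrightarrow> \<rho> w \<in> X" "\<And>w. w \<in> wo n \<Longrightarrow> prefix (\<rho> w) n = w"
proof -
  have "\<exists>x. x \<in> X \<and> prefix x n = w" if "w \<in> wo n" for w
    using words_extend[OF that] by blast
  then show ?thesis using that by metis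
qed

lemma S_split_gap: "x \<in> X \<Longrightarrow> \<bar>S (n + G) x - S n x\<bar> \<le> real G * F"
  using S_bound[OF shift_X, of x G n] by (simp add: birkhoff_add)

text \<open>Every word of length n begins some preimage of order n + G, and the measures of these
  words sum to 1. The excess G is removed by writing the sum as one over \<open>Pre n x\<close> with
  factors \<open>lw G\<close>, which are bounded.\<close>

lemma lw_lower: "\<exists>c>0. \<forall>n. \<forall>x\<in>X. c * exp (real n * P) \<le> lw n x"
proof -
  define c where "c = exp (- (real G * F) - real G * P) / C\<^sup>2"
  have "c * exp (real n * P) \<le> lw n x" if x: "x \<in> X" for n x
  proof -
    obtain \<eta> where eta: "\<And>w. w \<in> wo n \<Longrightarrow> \<eta> w \<in> Pre (n + G) x" "\<And>w. w \<in> wo n \<Longrightarrow> prefix (\<eta> w) n = w"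
      using choose_preimages[OF x] by metis
    have inj: "inj_on \<eta> (wo n)" by (rule inj_onI) (metis eta(2))
    have "exp (- (real G * F)) * exp (real n * P) / C = (\<Sum>w\<in>wo n. exp (- (real G * F)) * exp (real n * P) / C * m w)"
      unfolding sum_distrib_left[symmetric] sum_words by simp
    also have "\<dots> \<le> (\<Sum>w\<in>wo n. exp (S (n + G) (\<eta> w)))"
    proof (intro sum_mono)
      fix w assume w: "w \<in> wo n"
      have yX: "\<eta> w \<in> X" using eta(1)[OF w] PreD by blast
      have "exp (- (real G * F)) * exp (real n * P) / C * m w
          \<le> exp (- (real G * F)) * exp (real n * P) / C * (C * exp (S n (\<eta> w) - real n * P))"
        using gibbs_upper[OF yX, of n] eta(2)[OF w] C by (intro mult_left_mono) auto
      also have "\<dots> = exp (- (real G * F) + S n (\<eta> w))"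
        using C by (simp add: exp_add exp_diff exp_minus field_simps)
      also have "\<dots> \<le> exp (S (n + G) (\<eta> w))"
        using S_split_gap[OF yX, of n] by simp
      finally show "exp (- (real G * F)) * exp (real n * P) / C * m w \<le> exp (S (n + G) (\<eta> w))" .
    qed
    also have "\<dots> = (\<Sum>y\<in>\<eta> ` wo n. exp (S (n + G) y))" by (simp add: sum.reindex[OF inj])
    also have "\<dots> \<le> lw (n + G) x" unfolding lw_def using eta(1) by (intro sum_mono2) auto
    also have "\<dots> = (\<Sum>z\<in>Pre n x. exp (S n z) * lw G z)" by (simp add: lw_add add.commute[of n])
    also have "\<dots> \<le> (\<Sum>z\<in>Pre n x. exp (S n z) * (C * exp (real G * P)))"
      by (intro sum_mono mult_left_mono lw_upper) auto
    also have "\<dots> = lw n x * (C * exp (real G * P))" by (simp add: lw_def sum_distrib_right)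
    finally show ?thesis
      using C by (simp add: c_def exp_diff field_simps power2_eq_square)
  qed
  moreover have "c > 0" using C by (simp add: c_def)
  ultimately show ?thesis by blast
qed

lemma lw_pos: "x \<in> X \<Longrightarrow> lw n x > 0"
  using lw_lower by (meson exp_gt_zero less_le_trans mult_pos_pos)

lemma lw_comparable: "\<exists>L>0. \<forall>n. \<forall>x\<in>X. \<forall>y\<in>X. lw n x \<le> L * lw n y"
proof -
  obtain c where c: "c > 0" "\<And>n x. x \<in> X \<Longrightarrow> c * exp (real n * P) \<le> lw n x"
    using lw_lower by blast
  have "lw n x \<le> C / c * lw n y" if "y \<in> X" for n x y
  proof -
    have "lw n x \<le> C / c * (c * exp (real n * P))" using lw_upper[of n x] c(1) by simp
    also have "\<dots> \<le> C / c * lw n y" using C c that by (intro mult_left_mono) auto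
    finally show ?thesis .
  qed
  moreover have "C / c > 0" using C c by simp
  ultimately show ?thesis by blast
qed

section \<open>Bounded distortion and pairing of preimages\<close>

definition B :: real where "B = b / (1 - \<alpha>)"

lemma B: "B > 0" "b \<le> B"
proof -
  show "B > 0" using b alpha by (simp add: B_def)
  show "b \<le> B" using b alpha by (simp add: B_def field_simps)
qed

text \<open>The differences of f along the two orbits are dominated by a geometric series with total
  at most B \<alpha>^k.\<close>

lemma bounded_distortion:
  assumes "x \<in> X" "y \<in> X" "\<forall>j<n + k. x j = y j"
  shows "\<bar>S n x - S n y\<bar> \<le> B * \<alpha> ^ k"
proof -
  \<comment> \<open>The factor 1 - \<alpha>^n records the partial sum of the geometric series and
    makes the induction close.\<close>
  have "\<bar>S n x - S n y\<bar> \<le> B * \<alpha> ^ k * (1 - \<alpha> ^ n)"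
    using assms
  proof (induction n arbitrary: x y)
    case (Suc n)
    have "\<bar>S n ((shift ^^ 1) x) - S n ((shift ^^ 1) y)\<bar> \<le> B * \<alpha> ^ k * (1 - \<alpha> ^ n)"
      using Suc.prems by (intro Suc.IH shift_X) (auto simp: shift_def)
    moreover have "\<bar>f x - f y\<bar> \<le> b * \<alpha> ^ (Suc n + k)"
      using Suc.prems by (intro variation)
    moreover have "b * \<alpha> ^ (Suc n + k) \<le> B * (1 - \<alpha>) * \<alpha> ^ (n + k)"
      using alpha b by (simp add: B_def mult_left_le_one_le)
    moreover have "B * (1 - \<alpha>) * \<alpha> ^ (n + k) + B * \<alpha> ^ k * (1 - \<alpha> ^ n) = B * \<alpha> ^ k * (1 - \<alpha> ^ Suc n)"
      by (simp add: algebra_simps power_add)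
    ultimately show ?case
      using birkhoff_add[of f 1 n x] birkhoff_add[of f 1 n y] by (simp; linarith)
  qed simp
  also have "\<dots> \<le> B * \<alpha> ^ k" using B alpha by (simp add: mult_left_le)
  finally show ?thesis .
qed

text \<open>Moves a preimage z of one point to a preimage of y by exchanging the tail. The result
  stays admissible if both points start with the same symbol.\<close>

definition glue :: "nat \<Rightarrow> seq \<Rightarrow> seq \<Rightarrow> seq" where
  "glue n y z = (\<lambda>i. if i < n then z i else y (i - n))"

lemma glue_Pre:
  assumes y: "y \<in> X" "x 0 = y 0" and z: "z \<in> Pre n x"
  shows "glue n y z \<in> Pre n y"
proof -
  have zX: "z l \<in> {1..K}" "A (z l) (z (Suc l)) = 1" for l
    using PreD(1)[OF z] by (auto simp: SigmaA_def)
  have yX: "y l \<in> {1..K}" "A (y l) (y (Suc l)) = 1" for l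
    using y by (auto simp: SigmaA_def)
  have "A (glue n y z l) (glue n y z (Suc l)) = 1" for l
  proof -
    consider "Suc l < n" | "Suc l = n" | "n \<le> l" by linarith
    then show ?thesis
    proof cases
      case 2
      then show ?thesis using zX(2)[of l] Pre_nth[OF z, of 0] y(2) by (auto simp: glue_def)
    qed (use zX yX in \<open>auto simp: glue_def Suc_diff_le\<close>)
  qed
  then have "glue n y z \<in> X" using zX yX by (auto simp: SigmaA_def glue_def)
  moreover have "(shift ^^ n) (glue n y z) = y" by (rule ext) (simp add: shift_pow glue_def)
  ultimately show ?thesis by (simp add: Pre_def)
qed

lemma glue_glue: "z \<in> Pre n x \<Longrightarrow> glue n x (glue n y z) = z"
  using Pre_nth[of z n x] by (intro ext) (simp add: glue_def, metis le_add_diff_inverse not_less)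

lemma bij_glue:
  assumes "x \<in> X" "y \<in> X" "x 0 = y 0"
  shows "bij_betw (glue n y) (Pre n x) (Pre n y)"
  by (rule bij_betwI[where g = "glue n x"]) (use assms in \<open>auto intro: glue_Pre glue_glue\<close>)

lemma glue_agree: "z \<in> Pre n x \<Longrightarrow> \<forall>j<k. x j = y j \<Longrightarrow> \<forall>j<n + k. z j = glue n y z j"
  using Pre_nth[of z n x] by (auto simp: glue_def) (metis add_diff_inverse_nat nat_add_left_cancel_less)

text \<open>\<open>glue\<close> pairs the preimages of x and y bijectively, and paired preimages
  agree on n + k symbols.\<close>

lemma lw_regular:
  assumes "x \<in> X" "y \<in> X" "\<forall>j<k. x j = y j" "k \<ge> 1"
  shows "lw n x \<le> exp (B * \<alpha> ^ k) * lw n y"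
proof -
  have xy: "x 0 = y 0" using assms by simp
  have "lw n x \<le> (\<Sum>z\<in>Pre n x. exp (B * \<alpha> ^ k) * exp (S n (glue n y z)))"
    unfolding lw_def
  proof (intro sum_mono)
    fix z assume z: "z \<in> Pre n x"
    have "\<bar>S n z - S n (glue n y z)\<bar> \<le> B * \<alpha> ^ k"
      using glue_Pre[OF assms(2) xy z] glue_agree[OF z assms(3)] z PreD by (intro bounded_distortion) auto
    then show "exp (S n z) \<le> exp (B * \<alpha> ^ k) * exp (S n (glue n y z))"
      by (simp add: exp_add[symmetric])
  qed
  also have "\<dots> = exp (B * \<alpha> ^ k) * (\<Sum>z\<in>Pre n y. exp (S n z))"
    using sum.reindex_bij_betw[OF bij_glue[OF assms(1,2) xy], of "\<lambda>z. exp (S n z)" n]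
    by (simp add: sum_distrib_left[symmetric])
  finally show ?thesis by (simp add: lw_def)
qed

section \<open>Weighted means of Birkhoff sums and their regularity\<close>

definition mean :: "nat \<Rightarrow> seq \<Rightarrow> real" where
  "mean n x = (\<Sum>y\<in>Pre n x. exp (S n y) * S n y) / lw n x"

text \<open>The distribution of \<open>\<sigma>\<^sup>n y\<close> for a random \<open>y \<in> Pre (n + q) x\<close> with weights \<open>exp (S (n + q) y)\<close>.\<close>
definition tp :: "nat \<Rightarrow> nat \<Rightarrow> seq \<Rightarrow> seq \<Rightarrow> real" where
  "tp q n x z = exp (S q z) * lw n z / lw (n + q) x"

lemma tp_nonneg: "x \<in> X \<Longrightarrow> z \<in> Pre q x \<Longrightarrow> tp q n x z \<ge> 0"
  using lw_pos[of x "n + q"] lw_pos[of z n] PreD(1) by (auto simp: tp_def)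

lemma sum_tp: "x \<in> X \<Longrightarrow> (\<Sum>z\<in>Pre q x. tp q n x z) = 1"
  using lw_pos[of x "n + q"] lw_add[of n q x] by (simp add: tp_def sum_divide_distrib[symmetric])

text \<open>Total expectation: condition on z = \<sigma>^n y, which has the distribution
  \<open>tp q n x\<close>, and split the Birkhoff sum at time n.\<close>

lemma mean_add:
  assumes "x \<in> X"
  shows "mean (n + q) x = (\<Sum>z\<in>Pre q x. tp q n x z * (S q z + mean n z))"
proof -
  have "(\<Sum>y\<in>Pre (n + q) x. exp (S (n + q) y) * S (n + q) y)
      = (\<Sum>z\<in>Pre q x. exp (S q z) * lw n z * (S q z + mean n z))"
    unfolding sum_Pre_add
  proof (intro sum.cong refl)
    fix z assume z: "z \<in> Pre q x"
    have "(\<Sum>y\<in>Pre n z. exp (S (n + q) y) * S (n + q) y)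
        = (\<Sum>y\<in>Pre n z. exp (S q z) * (exp (S n y) * S n y) + exp (S q z) * S q z * exp (S n y))"
      by (intro sum.cong refl) (simp add: birkhoff_add PreD exp_add algebra_simps)
    also have "\<dots> = exp (S q z) * (\<Sum>y\<in>Pre n z. exp (S n y) * S n y) + exp (S q z) * S q z * lw n z"
      by (simp add: sum.distrib sum_distrib_left lw_def)
    also have "(\<Sum>y\<in>Pre n z. exp (S n y) * S n y) = lw n z * mean n z"
      using lw_pos[of z n] PreD(1)[OF z] by (simp add: mean_def)
    finally show "(\<Sum>y\<in>Pre n z. exp (S (n + q) y) * S (n + q) y)
        = exp (S q z) * lw n z * (S q z + mean n z)" by (simp add: algebra_simps)
  qed
  then show ?thesis
    unfolding mean_def[of "n + q"] by (simp add: sum_divide_distrib tp_def)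
qed

lemma mean_bound: "x \<in> X \<Longrightarrow> \<bar>mean n x\<bar> \<le> real n * F"
proof -
  assume x: "x \<in> X"
  have "\<bar>\<Sum>y\<in>Pre n x. exp (S n y) * S n y\<bar> \<le> (\<Sum>y\<in>Pre n x. exp (S n y) * (real n * F))"
    by (intro order_trans[OF sum_abs] sum_mono) (auto simp: abs_mult intro!: mult_left_mono S_bound PreD)
  also have "\<dots> = lw n x * (real n * F)" by (simp add: lw_def sum_distrib_right)
  finally show ?thesis using lw_pos[OF x, of n] by (simp add: mean_def field_simps)
qed

definition osc_le :: "nat \<Rightarrow> real \<Rightarrow> bool" where
  "osc_le n D \<longleftrightarrow> (\<forall>x\<in>X. \<forall>y\<in>X. \<bar>mean n x - mean n y\<bar> \<le> D)"

text \<open>Only k \<ge> 1 is considered, because points must share the first symbol for their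
  preimages to be paired.\<close>

definition hol_le :: "nat \<Rightarrow> real \<Rightarrow> bool" where
  "hol_le n h \<longleftrightarrow> (\<forall>x\<in>X. \<forall>y\<in>X. \<forall>k\<ge>1. (\<forall>j<k. x j = y j) \<longrightarrow> \<bar>mean n x - mean n y\<bar> \<le> h * \<alpha> ^ k)"

text \<open>\<open>mean (Suc n) x\<close> averages the values f z' + mean n z' over z' in
  \<open>Pre 1 x\<close>, and two such values differ by at most b + D.\<close>

lemma mean_step_deviation:
  assumes osc: "osc_le n D" and x: "x \<in> X" and z: "z \<in> Pre 1 x"
  shows "\<bar>(f z + mean n z) - mean (Suc n) x\<bar> \<le> b + D"
proof -
  have "\<bar>(f z + mean n z) - (\<Sum>z\<in>Pre 1 x. tp 1 n x z * (S 1 z + mean n z))\<bar> \<le> b + D"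
  proof (rule weighted_deviation)
    fix z' assume z': "z' \<in> Pre 1 x"
    have "\<bar>f z - f z'\<bar> \<le> b" using variation[of z z' 0] z z' PreD by auto
    moreover have "\<bar>mean n z - mean n z'\<bar> \<le> D" using osc z z' PreD by (auto simp: osc_le_def)
    ultimately show "\<bar>(f z + mean n z) - (S 1 z' + mean n z')\<bar> \<le> b + D" by simp
  qed (use tp_nonneg sum_tp x in auto)
  then show ?thesis using mean_add[OF x, of n 1] by simp
qed

definition B3 :: real where "B3 = 3 * B * exp (3 * B)"

text \<open>Three factors enter \<open>tp\<close>: the weight exp (f z) and the values of
  \<open>lw\<close> at z and at x. Each changes by a factor of at most exp (B \<alpha>^k), which
  explains the 3 B in \<open>B3\<close>.\<close>

lemma tp_regular:
  assumes x: "x \<in> X" and y: "y \<in> X" and agree: "\<forall>j<k. x j = y j" and k: "k \<ge> 1" and z: "z \<in> Pre 1 x"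
  shows "\<bar>tp 1 n x z - tp 1 n y (glue 1 y z)\<bar> \<le> B3 * \<alpha> ^ k * tp 1 n y (glue 1 y z)"
proof -
  have xy: "x 0 = y 0" using agree k by simp
  let ?z = "glue 1 y z"
  define t where "t = 3 * B * \<alpha> ^ k"
  have zy: "?z \<in> Pre 1 y" using glue_Pre[OF y xy z] .
  have zX: "z \<in> X" "?z \<in> X" using z zy PreD by auto
  have ag: "\<forall>j<1 + k. z j = ?z j" using glue_agree[OF z agree] .
  have ak: "\<alpha> ^ (1 + k) \<le> \<alpha> ^ k" using alpha by (intro power_decreasing) auto
  have fz: "\<bar>f z - f ?z\<bar> \<le> B * \<alpha> ^ k"
  proof -
    have "\<bar>f z - f ?z\<bar> \<le> b * \<alpha> ^ (1 + k)" using zX ag by (intro variation)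
    also have "\<dots> \<le> B * \<alpha> ^ k" using B b alpha ak by (intro mult_mono) auto
    finally show ?thesis .
  qed
  have le: "lw n z1 \<le> exp (B * \<alpha> ^ k) * lw n z2" if "z1 \<in> X" "z2 \<in> X" "\<forall>j<1 + k. z1 j = z2 j" for z1 z2
  proof -
    have "lw n z1 \<le> exp (B * \<alpha> ^ (1 + k)) * lw n z2" using that by (intro lw_regular) auto
    also have "\<dots> \<le> exp (B * \<alpha> ^ k) * lw n z2"
      using B ak lw_pos[OF that(2), of n] by (intro mult_right_mono) (auto intro: mult_left_mono)
    finally show ?thesis .
  qed
  have comp: "tp 1 n x1 z1 \<le> exp t * tp 1 n x2 z2"
    if "x1 \<in> X" "x2 \<in> X" "\<forall>j<k. x2 j = x1 j" "\<bar>f z1 - f z2\<bar> \<le> B * \<alpha> ^ k"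
      "lw n z1 \<le> exp (B * \<alpha> ^ k) * lw n z2" "z1 \<in> X" for x1 x2 z1 z2
  proof -
    have "lw (n + 1) x2 \<le> exp (B * \<alpha> ^ k) * lw (n + 1) x1" using that k by (intro lw_regular)
    then have "1 / lw (n + 1) x1 \<le> exp (B * \<alpha> ^ k) / lw (n + 1) x2"
      using lw_pos[OF that(1), of "n + 1"] lw_pos[OF that(2), of "n + 1"] by (simp add: field_simps)
    moreover have "exp (f z1) \<le> exp (B * \<alpha> ^ k) * exp (f z2)" using that(4) by (simp add: exp_add[symmetric])
    ultimately have "exp (f z1) * lw n z1 * (1 / lw (n + 1) x1)
        \<le> (exp (B * \<alpha> ^ k) * exp (f z2)) * (exp (B * \<alpha> ^ k) * lw n z2) * (exp (B * \<alpha> ^ k) / lw (n + 1) x2)"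
      using that(5) lw_pos[OF that(6), of n] lw_pos[OF that(1), of "n + 1"]
      by (intro mult_mono) auto
    also have "\<dots> = exp t * (exp (f z2) * lw n z2 / lw (n + 1) x2)"
    proof -
      have "exp t = exp (B * \<alpha> ^ k) * exp (B * \<alpha> ^ k) * exp (B * \<alpha> ^ k)"
        by (simp add: t_def exp_add[symmetric])
      then show ?thesis by simp
    qed
    finally show ?thesis by (simp add: tp_def)
  qed
  let ?p = "tp 1 n x z" and ?q = "tp 1 n y ?z"
  have pq: "?p \<le> exp t * ?q" using x y agree fz ag zX by (intro comp le) auto
  have qp: "?q \<le> exp t * ?p" using x y agree fz ag zX by (intro comp le) auto
  have q0: "?q \<ge> 0" using tp_nonneg[OF y zy] .
  have t0: "t \<ge> 0" using B alpha by (simp add: t_def)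
  have "?q - ?p \<le> (exp t - 1) * ?q"
  proof -
    have "?q * exp (- t) \<le> ?p" using qp by (simp add: exp_minus field_simps)
    \<comment> \<open>This is cosh t \<ge> 1; it brings the lower ratio bound into the form of the
      upper one, 1 - exp (- t) \<le> exp t - 1.\<close>
    moreover have "exp (- t) \<ge> 2 - exp t"
    proof -
      have "exp (t / 2) * exp (t / 2) = exp t" "exp (- t / 2) * exp (- t / 2) = exp (- t)"
        "exp (t / 2) * exp (- t / 2) = 1" by (simp_all flip: exp_add)
      moreover have "0 \<le> (exp (t / 2) - exp (- t / 2)) * (exp (t / 2) - exp (- t / 2))" by simp
      ultimately show ?thesis by (simp add: algebra_simps)
    qed
    then have "?q * (2 - exp t) \<le> ?q * exp (- t)" using q0 by (rule mult_left_mono)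
    ultimately show ?thesis by (simp add: algebra_simps)
  qed
  with pq have "\<bar>?p - ?q\<bar> \<le> (exp t - 1) * ?q" by (simp add: abs_le_iff algebra_simps)
  also have "\<dots> \<le> (t * exp (3 * B)) * ?q"
  proof (intro mult_right_mono q0)
    have "t \<le> 3 * B" using B alpha by (simp add: t_def mult_left_le power_le_one)
    then have "t * exp t \<le> t * exp (3 * B)" using t0 by (intro mult_left_mono) auto
    then show "exp t - 1 \<le> t * exp (3 * B)" using exp_minus_1_le[OF t0] by linarith
  qed
  finally show ?thesis by (simp add: t_def B3_def mult_ac)
qed

text \<open>An inequality of Doeblin-Fortet type. Paired preimages of order 1 agree in one symbol
  more, which contracts the old constant by \<alpha>; the change of the weights is multiplied by
  deviations of size b + D.\<close>

lemma hol_step: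
  assumes hol: "hol_le n h" and osc: "osc_le n D"
  shows "hol_le (Suc n) (\<alpha> * h + \<alpha> * b + B3 * (b + D))"
  unfolding hol_le_def
proof (intro ballI allI impI)
  fix x y k assume x: "x \<in> X" and y: "y \<in> X" and k: "(1::nat) \<le> k" and agree: "\<forall>j<k. x j = y j"
  have xy: "x 0 = y 0" using agree k by simp
  let ?\<tau> = "glue 1 y" and ?\<kappa> = "mean (Suc n) y"
  let ?v = "\<lambda>z. f z + mean n z"
  have \<tau>: "?\<tau> z \<in> Pre 1 y" if "z \<in> Pre 1 x" for z using glue_Pre[OF y xy that] .
  have sy: "(\<Sum>z\<in>Pre 1 x. tp 1 n y (?\<tau> z) * g (?\<tau> z)) = (\<Sum>z\<in>Pre 1 y. tp 1 n y z * g z)" for g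
    using sum.reindex_bij_betw[OF bij_glue[OF x y xy], of "\<lambda>z. tp 1 n y z * g z" 1] .
  have sumq: "(\<Sum>z\<in>Pre 1 x. tp 1 n y (?\<tau> z)) = 1" using sy[of "\<lambda>_. 1"] sum_tp[OF y, of 1 n] by simp
  have mx: "mean (Suc n) x = (\<Sum>z\<in>Pre 1 x. tp 1 n x z * ?v z)" using mean_add[OF x, of n 1] by simp
  have my: "?\<kappa> = (\<Sum>z\<in>Pre 1 x. tp 1 n y (?\<tau> z) * ?v (?\<tau> z))"
    using mean_add[OF y, of n 1] sy[of ?v] by simp
  \<comment> \<open>Both systems of weights sum to 1, so \<open>mean (Suc n) y\<close> may be
    subtracted from all values. The change of weights then multiplies deviations instead of means,
    which may grow linearly in n.\<close>
  have "mean (Suc n) x - ?\<kappa> = (\<Sum>z\<in>Pre 1 x. tp 1 n x z * (?v z - ?\<kappa>))"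
    using mx sum_tp[OF x, of 1 n] by (simp add: right_diff_distrib sum_subtractf sum_distrib_right[symmetric])
  moreover have "0 = (\<Sum>z\<in>Pre 1 x. tp 1 n y (?\<tau> z) * (?v (?\<tau> z) - ?\<kappa>))"
    using my sumq by (simp add: right_diff_distrib sum_subtractf sum_distrib_right[symmetric])
  ultimately have "mean (Suc n) x - ?\<kappa> = (\<Sum>z\<in>Pre 1 x. tp 1 n x z * (?v z - ?\<kappa>))
      - (\<Sum>z\<in>Pre 1 x. tp 1 n y (?\<tau> z) * (?v (?\<tau> z) - ?\<kappa>))" by simp
  also have "\<dots> = (\<Sum>z\<in>Pre 1 x. tp 1 n x z * (?v z - ?v (?\<tau> z))
      + (tp 1 n x z - tp 1 n y (?\<tau> z)) * (?v (?\<tau> z) - ?\<kappa>))"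
    unfolding sum_subtractf[symmetric] by (intro sum.cong refl) (simp add: algebra_simps)
  finally have eq: "mean (Suc n) x - ?\<kappa> = (\<Sum>z\<in>Pre 1 x. tp 1 n x z * (?v z - ?v (?\<tau> z))
      + (tp 1 n x z - tp 1 n y (?\<tau> z)) * (?v (?\<tau> z) - ?\<kappa>))" .
  have "\<bar>mean (Suc n) x - ?\<kappa>\<bar> \<le> (\<Sum>z\<in>Pre 1 x. tp 1 n x z * ((\<alpha> * b + \<alpha> * h) * \<alpha> ^ k)
      + (B3 * \<alpha> ^ k * tp 1 n y (?\<tau> z)) * (b + D))"
    unfolding eq
  proof (intro order_trans[OF sum_abs] sum_mono order_trans[OF abs_triangle_ineq] add_mono)
    fix z assume z: "z \<in> Pre 1 x"
    have zX: "z \<in> X" "?\<tau> z \<in> X" using z \<tau>[OF z] PreD by auto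
    have ag: "\<forall>j<1 + k. z j = ?\<tau> z j" using glue_agree[OF z agree] .
    have "\<bar>f z - f (?\<tau> z)\<bar> \<le> b * \<alpha> ^ (1 + k)" using zX ag by (intro variation)
    moreover have "\<bar>mean n z - mean n (?\<tau> z)\<bar> \<le> h * \<alpha> ^ (1 + k)"
      using hol zX ag unfolding hol_le_def by (meson le_add1)
    ultimately have "\<bar>?v z - ?v (?\<tau> z)\<bar> \<le> (\<alpha> * b + \<alpha> * h) * \<alpha> ^ k"
      by (simp add: algebra_simps abs_le_iff)
    then show "\<bar>tp 1 n x z * (?v z - ?v (?\<tau> z))\<bar> \<le> tp 1 n x z * ((\<alpha> * b + \<alpha> * h) * \<alpha> ^ k)"
      using tp_nonneg[OF x z, of n] by (simp add: abs_mult mult_left_mono)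
    show "\<bar>(tp 1 n x z - tp 1 n y (?\<tau> z)) * (?v (?\<tau> z) - ?\<kappa>)\<bar> \<le> (B3 * \<alpha> ^ k * tp 1 n y (?\<tau> z)) * (b + D)"
      unfolding abs_mult
    proof (rule mult_mono[OF tp_regular[OF x y agree k z] mean_step_deviation[OF osc y \<tau>[OF z]]])
      show "0 \<le> B3 * \<alpha> ^ k * tp 1 n y (?\<tau> z)"
        using B alpha tp_nonneg[OF y \<tau>[OF z], of n] by (simp add: B3_def)
    qed simp
  qed
  also have "\<dots> = (\<Sum>z\<in>Pre 1 x. tp 1 n x z) * ((\<alpha> * b + \<alpha> * h) * \<alpha> ^ k)
      + B3 * \<alpha> ^ k * (\<Sum>z\<in>Pre 1 x. tp 1 n y (?\<tau> z)) * (b + D)"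
    by (simp only: sum.distrib sum_distrib_left sum_distrib_right)
  also have "\<dots> = (\<alpha> * h + \<alpha> * b + B3 * (b + D)) * \<alpha> ^ k"
    unfolding sumq sum_tp[OF x] by (simp add: algebra_simps)
  finally show "\<bar>mean (Suc n) x - ?\<kappa>\<bar> \<le> (\<alpha> * h + \<alpha> * b + B3 * (b + D)) * \<alpha> ^ k" .
qed

section \<open>Contraction of oscillations\<close>

definition tpw :: "nat \<Rightarrow> nat \<Rightarrow> nat \<Rightarrow> seq \<Rightarrow> nat list \<Rightarrow> real" where
  "tpw q n r x v = (\<Sum>z\<in>{z \<in> Pre q x. prefix z r = v}. tp q n x z)"

lemma sum_by_prefix:
  "(\<Sum>z\<in>Pre q x. tp q n x z * U (prefix z r)) = (\<Sum>v\<in>wo r. tpw q n r x v * U v)"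
proof -
  have "(\<Sum>v\<in>wo r. tpw q n r x v * U v) = (\<Sum>v\<in>wo r. \<Sum>z\<in>{z \<in> Pre q x. prefix z r = v}. tp q n x z * U (prefix z r))"
    unfolding tpw_def sum_distrib_right by (intro sum.cong refl) auto
  also have "\<dots> = (\<Sum>z\<in>Pre q x. tp q n x z * U (prefix z r))"
    by (rule sum.group) (auto intro: finite_words prefix_words PreD)
  finally show ?thesis by simp
qed

text \<open>\<open>tpw\<close> is the law of the first r symbols of z under \<open>tp\<close>. This
  is a Doeblin minorization: with G free symbols every word v begins a preimage of every x, and
  bounded distortion and the comparability of \<open>lw\<close> make its weight comparable for all
  x.\<close>

lemma prefix_minorization:
  "\<exists>\<kappa>>0. \<forall>r n x y v. x \<in> X \<longrightarrow> y \<in> X \<longrightarrow> v \<in> wo r \<longrightarrow> \<kappa> * tpw (r + G) n r y v \<le> tpw (r + G) n r x v"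
proof -
  obtain L where L: "L > 0" "\<And>n x y. x \<in> X \<Longrightarrow> y \<in> X \<Longrightarrow> lw n x \<le> L * lw n y"
    using lw_comparable by blast
  define R where "R = exp (B + real G * F) * L\<^sup>2 * (C * exp (real G * P))"
  have R: "R > 0" using L C by (simp add: R_def)
  have "tpw (r + G) n r y v \<le> R * tpw (r + G) n r x v"
    if x: "x \<in> X" and y: "y \<in> X" and v: "v \<in> wo r" for r n x y v
  proof -
    let ?q = "r + G"
    \<comment> \<open>A single preimage of x beginning with v already carries enough weight.\<close>
    obtain y1 where y1: "y1 \<in> Pre ?q x" "prefix y1 r = v"
      using connect[OF v x] unfolding Pre_def by blast
    have y1X: "y1 \<in> X" using y1(1) PreD by blast
    have pos: "lw (n + ?q) x > 0" "lw (n + ?q) y > 0" using lw_pos x y by auto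
    let ?Z = "{z \<in> Pre ?q y. prefix z r = v}"
    have "tp ?q n y z \<le> exp (B + real G * F) * L\<^sup>2 * tp ?q n x y1 * exp (S G ((shift ^^ r) z))" if z: "z \<in> ?Z" for z
    proof -
      have zX: "z \<in> X" using z PreD by auto
      have "\<bar>S r z - S r y1\<bar> \<le> B * \<alpha> ^ 0"
        using z y1(2) by (intro bounded_distortion zX y1X) (auto simp: prefix_eq_iff)
      then have "S ?q z \<le> (B + real G * F + S ?q y1) + S G ((shift ^^ r) z)"
        using S_split_gap[OF y1X, of r] birkhoff_add[of f r G z] by simp
      then have e: "exp (S ?q z) \<le> exp (B + real G * F) * exp (S ?q y1) * exp (S G ((shift ^^ r) z))"
        by (simp add: exp_add[symmetric])
      have "1 / lw (n + ?q) y \<le> L / lw (n + ?q) x" using pos L(2)[OF x y, of "n + ?q"] by (simp add: field_simps)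
      then have "exp (S ?q z) * lw n z * (1 / lw (n + ?q) y)
          \<le> (exp (B + real G * F) * exp (S ?q y1) * exp (S G ((shift ^^ r) z))) * (L * lw n y1) * (L / lw (n + ?q) x)"
        using pos lw_pos[OF zX, of n] lw_pos[OF y1X, of n] L e
        by (intro mult_mono L(2) zX y1X) auto
      then show ?thesis by (simp add: tp_def power2_eq_square mult_ac)
    qed
    then have "tpw ?q n r y v \<le> (\<Sum>z\<in>?Z. exp (B + real G * F) * L\<^sup>2 * tp ?q n x y1 * exp (S G ((shift ^^ r) z)))"
      unfolding tpw_def by (intro sum_mono)
    also have "\<dots> = exp (B + real G * F) * L\<^sup>2 * tp ?q n x y1 * (\<Sum>z\<in>?Z. exp (S G ((shift ^^ r) z)))"
      by (rule sum_distrib_left[symmetric])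
    also have "\<dots> \<le> exp (B + real G * F) * L\<^sup>2 * tp ?q n x y1 * (C * exp (real G * P))"
    proof (intro mult_left_mono)
      \<comment> \<open>Preimages of y that begin with v differ only in the G symbols before y.
        \<sigma>^r maps them injectively into \<open>Pre G y\<close>, so the weights of the gap sum
        to at most \<open>lw G y\<close>.\<close>
      have inj: "inj_on (shift ^^ r) ?Z"
      proof (rule inj_onI)
        fix z z' assume z: "z \<in> ?Z" "z' \<in> ?Z" "(shift ^^ r) z = (shift ^^ r) z'"
        show "z = z'"
        proof
          fix j
          show "z j = z' j"
          proof (cases "j < r")
            case True
            then show ?thesis using z(1,2) nth_prefix[of j r z] nth_prefix[of j r z'] by auto
          next
            case False
            then show ?thesis using z(3) shift_pow[of r z "j - r"] shift_pow[of r z' "j - r"] by simp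
          qed
        qed
      qed
      have "(\<Sum>z\<in>?Z. exp (S G ((shift ^^ r) z))) = (\<Sum>z\<in>(shift ^^ r) ` ?Z. exp (S G z))"
        by (simp add: sum.reindex[OF inj])
      also have "\<dots> \<le> lw G y"
        unfolding lw_def
        by (intro sum_mono2 finite_Pre) (auto simp: Pre_def shift_X shift_pow_add add.commute)
      also have "\<dots> \<le> C * exp (real G * P)" by (rule lw_upper)
      finally show "(\<Sum>z\<in>?Z. exp (S G ((shift ^^ r) z))) \<le> C * exp (real G * P)" .
    qed (use tp_nonneg[OF x y1(1), of n] in auto)
    also have "\<dots> = R * tp ?q n x y1" by (simp add: R_def mult_ac)
    also have "\<dots> \<le> R * tpw ?q n r x v"
    proof (intro mult_left_mono)
      show "tp ?q n x y1 \<le> tpw ?q n r x v"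
        unfolding tpw_def using y1 tp_nonneg[OF x] by (intro member_le_sum) auto
    qed (use R in auto)
    finally show ?thesis .
  qed
  then have "\<forall>r n x y v. x \<in> X \<longrightarrow> y \<in> X \<longrightarrow> v \<in> wo r \<longrightarrow> 1 / R * tpw (r + G) n r y v \<le> tpw (r + G) n r x v"
    using R by (simp add: field_simps)
  moreover have "1 / R > 0" using R by simp
  ultimately show ?thesis by blast
qed

text \<open>Let q = r + G. Up to q F for the Birkhoff sum and h \<alpha>^r for replacing z by a
  representative of its prefix, \<open>mean (n + q)\<close> is an average of finitely many values
  under \<open>tpw\<close>. Two such laws share a proportion \<kappa> of their mass, which shrinks
  the oscillation D by 1 - \<kappa>.\<close>

lemma osc_step:
  assumes \<kappa>: "\<forall>r n x y v. x \<in> X \<longrightarrow> y \<in> X \<longrightarrow> v \<in> wo r \<longrightarrow> \<kappa> * tpw (r + G) n r y v \<le> tpw (r + G) n r x v"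
    and r: "r \<ge> 1" and osc: "osc_le n D" and hol: "hol_le n h"
  shows "osc_le (n + (r + G)) (2 * real (r + G) * F + 2 * h * \<alpha> ^ r + (1 - \<kappa>) * D)"
proof -
  let ?q = "r + G"
  obtain \<rho> where \<rho>: "\<And>v. v \<in> wo r \<Longrightarrow> \<rho> v \<in> X" "\<And>v. v \<in> wo r \<Longrightarrow> prefix (\<rho> v) r = v"
    using choose_words[of r] by metis
  define U where "U v = mean n (\<rho> v)" for v
  have approx: "\<bar>mean (n + ?q) x - (\<Sum>v\<in>wo r. tpw ?q n r x v * U v)\<bar> \<le> real ?q * F + h * \<alpha> ^ r" if x: "x \<in> X" for x
  proof -
    have eq: "mean (n + ?q) x - (\<Sum>v\<in>wo r. tpw ?q n r x v * U v)
        = (\<Sum>z\<in>Pre ?q x. tp ?q n x z * (S ?q z + (mean n z - U (prefix z r))))"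
    proof -
      have "(\<Sum>z\<in>Pre ?q x. tp ?q n x z * (S ?q z + mean n z)) - (\<Sum>z\<in>Pre ?q x. tp ?q n x z * U (prefix z r))
          = (\<Sum>z\<in>Pre ?q x. tp ?q n x z * (S ?q z + (mean n z - U (prefix z r))))"
        unfolding sum_subtractf[symmetric] by (intro sum.cong refl) (simp add: algebra_simps)
      then show ?thesis by (simp only: mean_add[OF x, of n ?q] sum_by_prefix[of ?q n x U r])
    qed
    have "\<bar>mean (n + ?q) x - (\<Sum>v\<in>wo r. tpw ?q n r x v * U v)\<bar>
        \<le> (\<Sum>z\<in>Pre ?q x. tp ?q n x z * (real ?q * F + h * \<alpha> ^ r))"
      unfolding eq
    proof (intro order_trans[OF sum_abs] sum_mono)
      fix z assume z: "z \<in> Pre ?q x"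
      have zX: "z \<in> X" and w: "prefix z r \<in> wo r" using z PreD prefix_words by auto
      have "\<forall>j<r. z j = \<rho> (prefix z r) j" using \<rho>(2)[OF w] by (metis prefix_eq_iff)
      then have "\<bar>mean n z - U (prefix z r)\<bar> \<le> h * \<alpha> ^ r"
        using hol zX \<rho>(1)[OF w] r unfolding hol_le_def U_def by blast
      then have "\<bar>S ?q z + (mean n z - U (prefix z r))\<bar> \<le> real ?q * F + h * \<alpha> ^ r"
        using S_bound[OF zX, of ?q] by linarith
      then show "\<bar>tp ?q n x z * (S ?q z + (mean n z - U (prefix z r)))\<bar> \<le> tp ?q n x z * (real ?q * F + h * \<alpha> ^ r)"
        using tp_nonneg[OF x z, of n] by (simp add: abs_mult mult_left_mono)
    qed
    also have "\<dots> = real ?q * F + h * \<alpha> ^ r"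
      unfolding sum_distrib_right[symmetric] sum_tp[OF x] by simp
    finally show ?thesis .
  qed
  have sum1: "(\<Sum>v\<in>wo r. tpw ?q n r x v) = 1" if "x \<in> X" for x
    using sum_by_prefix[of ?q n x "\<lambda>_. 1" r] sum_tp[OF that] by simp
  have diff: "(\<Sum>v\<in>wo r. tpw ?q n r x v * U v) - (\<Sum>v\<in>wo r. tpw ?q n r y v * U v) \<le> (1 - \<kappa>) * D"
    if x: "x \<in> X" and y: "y \<in> X" for x y
  proof -
    \<comment> \<open>Subtracting the minimum makes the values nonnegative, so that the minorization
      can be multiplied by them.\<close>
    define a where "a = Min (U ` wo r)"
    have ne: "wo r \<noteq> {}" using prefix_words[OF x] by blast
    have aU: "a \<le> U v" if "v \<in> wo r" for v
      using that finite_words by (auto simp: a_def intro: Min_le)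
    have Ua: "U v - a \<le> D" if v: "v \<in> wo r" for v
    proof -
      have "a \<in> U ` wo r" unfolding a_def using finite_words ne by (intro Min_in) auto
      then obtain v' where v': "v' \<in> wo r" "a = U v'" by blast
      have "\<bar>U v - U v'\<bar> \<le> D" using osc \<rho>(1) v v'(1) by (simp add: osc_le_def U_def)
      then show ?thesis using v'(2) by simp
    qed
    have "(\<Sum>v\<in>wo r. tpw ?q n r x v * U v) - (\<Sum>v\<in>wo r. tpw ?q n r y v * U v)
        = (\<Sum>v\<in>wo r. (tpw ?q n r x v - tpw ?q n r y v) * (U v - a))"
    proof -
      have "(\<Sum>v\<in>wo r. (tpw ?q n r x v - tpw ?q n r y v) * (U v - a))
          = (\<Sum>v\<in>wo r. tpw ?q n r x v * U v - tpw ?q n r y v * U v - (tpw ?q n r x v * a - tpw ?q n r y v * a))"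
        by (intro sum.cong refl) (simp add: algebra_simps)
      then show ?thesis
        unfolding sum_subtractf sum_distrib_right[symmetric] sum1[OF x] sum1[OF y] by simp
    qed
    also have "\<dots> \<le> (\<Sum>v\<in>wo r. ((1 - \<kappa>) * tpw ?q n r x v) * D)"
    proof (intro sum_mono)
      fix v assume v: "v \<in> wo r"
      have k: "\<kappa> * tpw ?q n r x v \<le> tpw ?q n r y v" using \<kappa>[rule_format, OF y x v] .
      \<comment> \<open>The minorization with both points equal to x gives this sign without a
        separate proof of \<kappa> \<le> 1.\<close>
      have k1: "0 \<le> (1 - \<kappa>) * tpw ?q n r x v"
        using \<kappa>[rule_format, OF x x v, of n] by (simp add: left_diff_distrib)
      have "(tpw ?q n r x v - tpw ?q n r y v) * (U v - a) \<le> ((1 - \<kappa>) * tpw ?q n r x v) * (U v - a)"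
        using k aU[OF v] by (intro mult_right_mono) (auto simp: algebra_simps)
      also have "\<dots> \<le> ((1 - \<kappa>) * tpw ?q n r x v) * D"
        using Ua[OF v] k1 by (rule mult_left_mono)
      finally show "(tpw ?q n r x v - tpw ?q n r y v) * (U v - a) \<le> ((1 - \<kappa>) * tpw ?q n r x v) * D" .
    qed
    also have "\<dots> = (1 - \<kappa>) * D"
      unfolding sum_distrib_right[symmetric] sum_distrib_left[symmetric] sum1[OF x] by simp
    finally show ?thesis .
  qed
  show ?thesis
    unfolding osc_le_def
  proof (intro ballI)
    fix x y assume x: "x \<in> X" and y: "y \<in> X"
    show "\<bar>mean (n + ?q) x - mean (n + ?q) y\<bar> \<le> 2 * real ?q * F + 2 * h * \<alpha> ^ r + (1 - \<kappa>) * D"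
      using approx[OF x] approx[OF y] diff[OF x y] diff[OF y x] by (simp only: abs_le_iff) linarith
  qed
qed

text \<open>Oscillation bounds propagate to Hoelder bounds by \<open>hol_step\<close>, and these give back an
  oscillation bound contracted by the minorization.\<close>
lemma osc_uniform: "\<exists>D. \<forall>n. osc_le n D"
proof -
  obtain \<kappa> where \<kappa>: "\<kappa> > 0"
    "\<forall>r n x y v. x \<in> X \<longrightarrow> y \<in> X \<longrightarrow> v \<in> wo r \<longrightarrow> \<kappa> * tpw (r + G) n r y v \<le> tpw (r + G) n r x v"
    using prefix_minorization by blast
  have B3: "B3 > 0" using B by (simp add: B3_def)
  \<comment> \<open>\<open>h0 + h1 * D\<close> is the fixed point in h of the bound in
    \<open>hol_step\<close>, as checked in \<open>Hfix\<close>.\<close>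
  define h0 h1 where "h0 = (\<alpha> * b + B3 * b) / (1 - \<alpha>)" and "h1 = B3 / (1 - \<alpha>)"
  have h01: "h0 > 0" "h1 > 0" using alpha b B3 by (auto simp: h0_def h1_def intro!: divide_pos_pos add_pos_pos)
  have "(\<lambda>r. 2 * h1 * \<alpha> ^ r) \<longlonglongrightarrow> 2 * h1 * 0"
    using alpha by (intro tendsto_mult_left LIMSEQ_power_zero) simp
  then have "eventually (\<lambda>r. 2 * h1 * \<alpha> ^ r < \<kappa> / 2) sequentially"
    using \<kappa>(1) by (intro order_tendstoD(2)) auto
  \<comment> \<open>This r makes the part of the Hoelder error that is proportional to D at most
    half of the gain \<kappa> D.\<close>
  then obtain r where r: "r \<ge> 1" "2 * h1 * \<alpha> ^ r \<le> \<kappa> / 2"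
    unfolding eventually_sequentially by (metis less_imp_le max.cobounded1 max.cobounded2)
  let ?q = "r + G"
  \<comment> \<open>The first entry covers n < r + G by the trivial bound; the second absorbs the
    terms free of D into the other half of \<kappa> D.\<close>
  define D where "D = max (2 * real ?q * F) ((2 * real ?q * F + 2 * h0) * 2 / \<kappa>)"
  have D0: "D \<ge> 0" using F(1) by (simp add: D_def le_max_iff_disj)
  define H where "H = h0 + h1 * D"
  have Hfix: "\<alpha> * H + \<alpha> * b + B3 * (b + D) = H"
  proof -
    have "(1 - \<alpha>) * h0 = \<alpha> * b + B3 * b" "(1 - \<alpha>) * h1 = B3"
      using alpha by (simp_all add: h0_def h1_def)
    then have "(1 - \<alpha>) * h0 + (1 - \<alpha>) * h1 * D = \<alpha> * b + B3 * b + B3 * D" by simp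
    moreover have "\<alpha> * H = H - ((1 - \<alpha>) * h0 + (1 - \<alpha>) * h1 * D)"
      by (simp add: H_def left_diff_distrib distrib_left mult.assoc)
    ultimately show ?thesis by (simp add: distrib_left)
  qed
  have H0: "H > 0" using h01 D0 by (simp add: H_def add_pos_nonneg)
  have hol: "hol_le n H" if "\<And>j. j < n \<Longrightarrow> osc_le j D" for n
    using that
  proof (induction n)
    case 0
    have "mean 0 x = 0" for x by (simp add: mean_def)
    then show ?case using H0 alpha by (simp add: hol_le_def)
  next
    case (Suc n)
    then show ?case using hol_step[of n H D] Hfix by simp
  qed
  have "osc_le n D" for n
  proof (induction n rule: less_induct)
    case (less n)
    show ?case
    proof (cases "n < ?q")
      case True
      show ?thesis
        unfolding osc_le_def
      proof (intro ballI)
        fix x y assume "x \<in> X" "y \<in> X"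
        then have "\<bar>mean n x - mean n y\<bar> \<le> 2 * (real n * F)"
          using mean_bound[of x n] mean_bound[of y n] by linarith
        also have "\<dots> \<le> 2 * (real ?q * F)" using True F(1) by (intro mult_left_mono mult_right_mono) auto
        also have "\<dots> \<le> D" unfolding mult.assoc[symmetric] D_def by (rule max.cobounded1)
        finally show "\<bar>mean n x - mean n y\<bar> \<le> D" .
      qed
    next
      case False
      then obtain j where j: "n = j + ?q" by (metis add.commute le_Suc_ex not_less)
      then have "j < n" using r(1) by simp
      then have "osc_le j D" "hol_le j H" using less.IH hol[of j] by auto
      from osc_step[OF \<kappa>(2) r(1) this]
      have "osc_le n (2 * real ?q * F + 2 * H * \<alpha> ^ r + (1 - \<kappa>) * D)" using j by simp
      moreover have "2 * real ?q * F + 2 * H * \<alpha> ^ r + (1 - \<kappa>) * D \<le> D"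
      proof -
        have "2 * h0 * \<alpha> ^ r \<le> 2 * h0" using h01 alpha by (simp add: mult_left_le power_le_one)
        moreover have "(2 * h1 * \<alpha> ^ r) * D \<le> \<kappa> / 2 * D" using r(2) D0 by (rule mult_right_mono)
        ultimately have "2 * H * \<alpha> ^ r \<le> 2 * h0 + \<kappa> / 2 * D" by (simp add: H_def algebra_simps)
        moreover have "(2 * real ?q * F + 2 * h0) * 2 / \<kappa> \<le> D" unfolding D_def by (rule max.cobounded2)
        then have "2 * real ?q * F + 2 * h0 \<le> \<kappa> / 2 * D" using \<kappa>(1) by (simp add: field_simps)
        ultimately show ?thesis by (simp add: algebra_simps)
      qed
      ultimately show ?thesis unfolding osc_le_def by (meson order_trans)
    qed
  qed
  then show ?thesis by blast
qed

text \<open>Pythagoras for conditional expectations: with z = \<sigma>^n y, the variance of order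
  \<open>Suc n\<close> is the average variance of order n plus the variance of f z + mean n z, and
  the latter is at most (b + D)^2.\<close>

lemma weighted_variance:
  assumes D: "\<And>n. osc_le n D" and x: "x \<in> X"
  shows "(\<Sum>y\<in>Pre n x. exp (S n y) * (S n y - mean n x)\<^sup>2) \<le> real n * (b + D)\<^sup>2 * lw n x"
  using x
proof (induction n arbitrary: x)
  case 0
  have "S 0 y - mean 0 x = 0" for y by (simp add: mean_def)
  then show ?case by simp
next
  case (Suc n)
  have "(\<Sum>y\<in>Pre (n + 1) x. exp (S (n + 1) y) * (S (n + 1) y - mean (Suc n) x)\<^sup>2)
      \<le> (\<Sum>z\<in>Pre 1 x. exp (f z) * lw n z * (real (Suc n) * (b + D)\<^sup>2))"
    unfolding sum_Pre_add
  proof (intro sum_mono)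
    fix z assume z: "z \<in> Pre 1 x"
    have zX: "z \<in> X" using z PreD by blast
    let ?d = "f z + mean n z - mean (Suc n) x"
    have "(\<Sum>y\<in>Pre n z. exp (S (n + 1) y) * (S (n + 1) y - mean (Suc n) x)\<^sup>2)
        = (\<Sum>y\<in>Pre n z. exp (f z) * (exp (S n y) * (S n y - mean n z)\<^sup>2
            + 2 * ?d * (exp (S n y) * S n y - mean n z * exp (S n y)) + ?d\<^sup>2 * exp (S n y)))"
    proof (intro sum.cong refl)
      fix y assume "y \<in> Pre n z"
      then have e: "S (n + 1) y = S n y + f z" using birkhoff_add[of f n 1 y] PreD(2) by simp
      show "exp (S (n + 1) y) * (S (n + 1) y - mean (Suc n) x)\<^sup>2 = exp (f z) * (exp (S n y) * (S n y - mean n z)\<^sup>2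
            + 2 * ?d * (exp (S n y) * S n y - mean n z * exp (S n y)) + ?d\<^sup>2 * exp (S n y))"
        unfolding e exp_add by (simp add: power2_eq_square algebra_simps)
    qed
    also have "\<dots> = exp (f z) * ((\<Sum>y\<in>Pre n z. exp (S n y) * (S n y - mean n z)\<^sup>2)
        + 2 * ?d * ((\<Sum>y\<in>Pre n z. exp (S n y) * S n y) - mean n z * lw n z) + ?d\<^sup>2 * lw n z)"
      unfolding lw_def sum.distrib sum_distrib_left[symmetric] sum_subtractf by simp
    \<comment> \<open>The mixed term vanishes by the definition of \<open>mean\<close>.\<close>
    also have "(\<Sum>y\<in>Pre n z. exp (S n y) * S n y) - mean n z * lw n z = 0"
      using lw_pos[OF zX, of n] by (simp add: mean_def)
    also have "exp (f z) * ((\<Sum>y\<in>Pre n z. exp (S n y) * (S n y - mean n z)\<^sup>2) + 2 * ?d * 0 + ?d\<^sup>2 * lw n z)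
        \<le> exp (f z) * (real n * (b + D)\<^sup>2 * lw n z + 2 * ?d * 0 + (b + D)\<^sup>2 * lw n z)"
    proof (rule mult_left_mono, intro add_mono Suc.IH zX order_refl, rule mult_right_mono)
      have "\<bar>?d\<bar> \<le> b + D" using mean_step_deviation[OF D Suc.prems z, of n] by simp
      then have "\<bar>?d\<bar>\<^sup>2 \<le> (b + D)\<^sup>2" by (intro power_mono) auto
      then show "?d\<^sup>2 \<le> (b + D)\<^sup>2" by simp
    qed (use lw_pos[OF zX, of n] in auto)
    also have "\<dots> = exp (f z) * lw n z * (real (Suc n) * (b + D)\<^sup>2)" by (simp add: algebra_simps)
    finally show "(\<Sum>y\<in>Pre n z. exp (S (n + 1) y) * (S (n + 1) y - mean (Suc n) x)\<^sup>2)
        \<le> exp (f z) * lw n z * (real (Suc n) * (b + D)\<^sup>2)" .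
  qed
  also have "\<dots> = real (Suc n) * (b + D)\<^sup>2 * lw (n + 1) x"
    unfolding lw_add by (simp add: sum_distrib_left sum_distrib_right mult_ac)
  finally show ?case by simp
qed

section \<open>From weighted preimages to integrals over the Gibbs measure\<close>

lemma sum_indicator_words:
  "x \<in> X \<Longrightarrow> (\<Sum>w\<in>wo n. \<Phi> w * indicator (cy w) x) = (\<Phi> (prefix x n) :: real)"
proof -
  assume x: "x \<in> X"
  have "indicator (cy w) x = (if prefix x n = w then 1 else 0 :: real)" if "w \<in> wo n" for w
    using that x by (auto simp: cyl_def words_def prefix_eq_conv indicator_def)
  then have "(\<Sum>w\<in>wo n. \<Phi> w * indicator (cy w) x) = (\<Sum>w\<in>wo n. if prefix x n = w then \<Phi> w else 0)"
    by (intro sum.cong) auto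
  then show ?thesis using prefix_words[OF x] finite_words by (simp add: sum.delta')
qed

lemma integrable_prefix: "integrable \<mu> (\<lambda>x. \<Phi> (prefix x n) :: real)"
  and integral_prefix: "(\<integral>x. \<Phi> (prefix x n) \<partial>\<mu>) = (\<Sum>w\<in>wo n. m w * \<Phi> w)"
proof -
  have eq: "x \<in> space \<mu> \<Longrightarrow> (\<Sum>w\<in>wo n. \<Phi> w * indicator (cy w) x) = \<Phi> (prefix x n)" for x
    by (simp add: sum_indicator_words space_mu)
  have int: "integrable \<mu> (\<lambda>x. \<Phi> w * indicator (cy w) x)" for w
    by (simp add: integrable_indicator_iff emeasure_eq_measure)
  have "integrable \<mu> (\<lambda>x. \<Sum>w\<in>wo n. \<Phi> w * indicator (cy w) x)"
    by (intro Bochner_Integration.integrable_sum int)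
  then show "integrable \<mu> (\<lambda>x. \<Phi> (prefix x n))"
    using eq by (subst (asm) Bochner_Integration.integrable_cong[OF refl]) auto
  have cX: "cy w \<inter> space \<mu> = cy w" for w by (auto simp: space_mu cyl_def)
  have "(\<integral>x. \<Phi> (prefix x n) \<partial>\<mu>) = (\<integral>x. (\<Sum>w\<in>wo n. \<Phi> w * indicator (cy w) x) \<partial>\<mu>)"
    using eq by (intro Bochner_Integration.integral_cong) auto
  also have "\<dots> = (\<Sum>w\<in>wo n. m w * \<Phi> w)"
    by (subst Bochner_Integration.integral_sum[OF int]) (simp add: cX mult.commute)
  finally show "(\<integral>x. \<Phi> (prefix x n) \<partial>\<mu>) = (\<Sum>w\<in>wo n. m w * \<Phi> w)" .
qed

text \<open>f is the pointwise limit of its values at representatives of the prefixes of length n,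
  which are functions of finitely many symbols.\<close>

lemma meas_f [measurable]: "f \<in> borel_measurable \<mu>"
proof -
  have "\<exists>\<rho>. \<forall>w\<in>wo n. \<rho> w \<in> X \<and> prefix (\<rho> w) n = w" for n
    using choose_words[of n] by metis
  then obtain \<rho> where \<rho>: "\<And>n w. w \<in> wo n \<Longrightarrow> \<rho> n w \<in> X \<and> prefix (\<rho> n w) n = w"
    by metis
  show ?thesis
  proof (rule borel_measurable_LIMSEQ_real)
    fix n
    show "(\<lambda>x. f (\<rho> n (prefix x n))) \<in> borel_measurable \<mu>"
      by (rule borel_measurable_integrable[OF integrable_prefix])
  next
    fix x assume "x \<in> space \<mu>"
    then have x: "x \<in> X" by (simp add: space_mu)
    have "\<bar>f (\<rho> n (prefix x n)) - f x\<bar> \<le> b * \<alpha> ^ n" for n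
      using \<rho>[OF prefix_words[OF x], of n] by (intro variation x) (auto simp: prefix_eq_iff)
    note le = this
    have "(\<lambda>n. b * \<alpha> ^ n) \<longlonglongrightarrow> b * 0"
      using alpha by (intro tendsto_mult_left LIMSEQ_power_zero) simp
    then have lim: "(\<lambda>n. b * \<alpha> ^ n) \<longlonglongrightarrow> 0" by simp
    have "(\<lambda>n. f (\<rho> n (prefix x n)) - f x) \<longlonglongrightarrow> 0"
      by (rule Lim_null_comparison[OF _ lim]) (simp add: le)
    then show "(\<lambda>n. f (\<rho> n (prefix x n))) \<longlonglongrightarrow> f x" by (simp add: LIM_zero_iff)
  qed
qed

lemma meas_S [measurable]: "S n \<in> borel_measurable \<mu>"
  unfolding birkhoff_def
  by (intro borel_measurable_sum measurable_compose[OF shift_pow_meas meas_f])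

lemma integrable_S: "integrable \<mu> (S n)"
  by (rule integrable_const_bound[where B = "real n * F"]) (auto simp: space_mu S_bound)

lemma integrable_S2: "integrable \<mu> (\<lambda>x. (S n x - a)\<^sup>2)"
proof (rule integrable_const_bound[where B = "(real n * F + \<bar>a\<bar>)\<^sup>2"])
  show "AE x in \<mu>. norm ((S n x - a)\<^sup>2) \<le> (real n * F + \<bar>a\<bar>)\<^sup>2"
  proof (rule AE_I2)
    fix x assume "x \<in> space \<mu>"
    then have "\<bar>S n x - a\<bar> \<le> real n * F + \<bar>a\<bar>" using S_bound[of x n] space_mu by simp
    then have "\<bar>S n x - a\<bar>\<^sup>2 \<le> (real n * F + \<bar>a\<bar>)\<^sup>2" by (intro power_mono) auto
    then show "norm ((S n x - a)\<^sup>2) \<le> (real n * F + \<bar>a\<bar>)\<^sup>2" by simp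
  qed
qed simp

text \<open>Transfers the variance bound from the weighted preimages of one point z0 to \<mu>: each
  word w of length n is represented by a preimage of order n + G beginning with w, and m(w) is at
  most a constant times its normalised weight.\<close>

lemma variance_linear: "\<exists>V>0. \<forall>n. \<exists>a. (\<integral>x. (S n x - a)\<^sup>2 \<partial>\<mu>) \<le> V * (real n + 1)"
proof -
  obtain D where D: "\<And>n. osc_le n D" using osc_uniform by blast
  obtain z0 where z0: "z0 \<in> X" using X_nonempty by blast
  \<comment> \<open>E bounds |S n x - S (n + G) y| for x and the representative y of its prefix; k2
    is the constant in the comparison of m(w) with the weight.\<close>
  define E where "E = B + real G * F"
  define k2 where "k2 = C * exp (real G * F) * (C * exp (real G * P))"
  have k2: "k2 > 0" using C by (simp add: k2_def)
  have E0: "E > 0" using B F(1) by (simp add: E_def add_pos_nonneg)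
  define V where "V = 2 * k2 * (real G + 1) * (b + D)\<^sup>2 + 2 * E\<^sup>2"
  have "\<exists>a. (\<integral>x. (S n x - a)\<^sup>2 \<partial>\<mu>) \<le> V * (real n + 1)" for n
  proof -
    let ?N = "n + G"
    define a where "a = mean ?N z0"
    obtain \<eta> where eta: "\<And>w. w \<in> wo n \<Longrightarrow> \<eta> w \<in> Pre ?N z0" "\<And>w. w \<in> wo n \<Longrightarrow> prefix (\<eta> w) n = w"
      using choose_preimages[OF z0] by metis
    have inj: "inj_on \<eta> (wo n)" by (rule inj_onI) (metis eta(2))
    have l0: "lw ?N z0 > 0" using lw_pos[OF z0] .
    define \<Phi> where "\<Phi> w = 2 * (S ?N (\<eta> w) - a)\<^sup>2 + 2 * E\<^sup>2" for w
    have "(\<integral>x. (S n x - a)\<^sup>2 \<partial>\<mu>) \<le> (\<integral>x. \<Phi> (prefix x n) \<partial>\<mu>)"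
    proof (rule integral_mono[OF integrable_S2 integrable_prefix])
      fix x assume "x \<in> space \<mu>"
      then have x: "x \<in> X" by (simp add: space_mu)
      let ?y = "\<eta> (prefix x n)"
      have y: "?y \<in> X" "prefix ?y n = prefix x n"
        using PreD(1)[OF eta(1)[OF prefix_words[OF x]]] eta(2)[OF prefix_words[OF x]] by auto
      have "\<bar>S n x - S n ?y\<bar> \<le> B * \<alpha> ^ 0"
        using y by (intro bounded_distortion x) (auto simp: prefix_eq_iff)
      then have "\<bar>S n x - S ?N ?y\<bar> \<le> E" using S_split_gap[OF y(1), of n] by (simp add: E_def)
      then have "\<bar>S n x - S ?N ?y\<bar>\<^sup>2 \<le> E\<^sup>2" by (intro power_mono) auto
      moreover have "(S n x - a)\<^sup>2 \<le> 2 * (S ?N ?y - a)\<^sup>2 + 2 * (S n x - S ?N ?y)\<^sup>2"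
      proof -
        have "0 \<le> ((S ?N ?y - a) - (S n x - S ?N ?y))\<^sup>2" by simp
        then show ?thesis by (simp add: power2_eq_square algebra_simps)
      qed
      ultimately show "(S n x - a)\<^sup>2 \<le> \<Phi> (prefix x n)" by (simp add: \<Phi>_def)
    qed
    also have "\<dots> = (\<Sum>w\<in>wo n. m w * (2 * (S ?N (\<eta> w) - a)\<^sup>2)) + 2 * E\<^sup>2"
      unfolding integral_prefix by (simp add: \<Phi>_def distrib_left sum.distrib sum_distrib_right[symmetric] sum_words)
    also have "(\<Sum>w\<in>wo n. m w * (2 * (S ?N (\<eta> w) - a)\<^sup>2))
        \<le> (\<Sum>w\<in>wo n. k2 / lw ?N z0 * exp (S ?N (\<eta> w)) * (2 * (S ?N (\<eta> w) - a)\<^sup>2))"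
    proof (intro sum_mono mult_right_mono)
      fix w assume w: "w \<in> wo n"
      have yX: "\<eta> w \<in> X" using eta(1)[OF w] PreD by blast
      have "m w \<le> C * exp (S n (\<eta> w) - real n * P)" using gibbs_upper[OF yX, of n] eta(2)[OF w] by simp
      also have "\<dots> \<le> C * exp (real G * F + S ?N (\<eta> w) - real n * P)"
        using C S_split_gap[OF yX, of n] by simp
      also have "\<dots> = C * exp (real G * F) * exp (S ?N (\<eta> w)) * exp (- real n * P)"
        by (simp add: exp_add[symmetric])
      also have "exp (- real n * P) \<le> C * exp (real G * P) / lw ?N z0"
        using lw_upper[of ?N z0] l0 by (simp add: field_simps exp_add[symmetric] exp_minus distrib_right)
      then have "C * exp (real G * F) * exp (S ?N (\<eta> w)) * exp (- real n * P)
          \<le> C * exp (real G * F) * exp (S ?N (\<eta> w)) * (C * exp (real G * P) / lw ?N z0)"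
        using C by (intro mult_left_mono) auto
      also have "\<dots> = k2 / lw ?N z0 * exp (S ?N (\<eta> w))" by (simp add: k2_def)
      finally show "m w \<le> k2 / lw ?N z0 * exp (S ?N (\<eta> w))" by simp
    qed simp
    also have "\<dots> = 2 * (k2 / lw ?N z0) * (\<Sum>y\<in>\<eta> ` wo n. exp (S ?N y) * (S ?N y - a)\<^sup>2)"
      by (simp add: sum.reindex[OF inj] sum_distrib_left mult_ac)
    also have "\<dots> \<le> 2 * (k2 / lw ?N z0) * (\<Sum>y\<in>Pre ?N z0. exp (S ?N y) * (S ?N y - a)\<^sup>2)"
      using eta(1) k2 l0 by (intro mult_left_mono sum_mono2) auto
    also have "\<dots> \<le> 2 * (k2 / lw ?N z0) * (real ?N * (b + D)\<^sup>2 * lw ?N z0)"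
      unfolding a_def using k2 l0 by (intro mult_left_mono weighted_variance D z0) auto
    also have "\<dots> = 2 * k2 * real ?N * (b + D)\<^sup>2" using l0 by simp
    also have "2 * k2 * real ?N * (b + D)\<^sup>2 \<le> 2 * k2 * ((real G + 1) * (real n + 1)) * (b + D)\<^sup>2"
      using k2 by (intro mult_right_mono mult_left_mono) (auto simp: algebra_simps)
    also have "\<dots> + 2 * E\<^sup>2 \<le> V * (real n + 1)"
    proof -
      have "2 * E\<^sup>2 * 1 \<le> 2 * E\<^sup>2 * (real n + 1)" by (intro mult_left_mono) auto
      then show ?thesis by (simp add: V_def algebra_simps)
    qed
    finally show ?thesis by (intro exI[of _ a]) simp
  qed
  moreover have "V > 0" using k2 E0 by (simp add: V_def add_nonneg_pos)
  ultimately show ?thesis by blast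
qed

section \<open>Almost sure returns\<close>

definition f_mean :: real where "f_mean = (\<integral>x. f x \<partial>\<mu>)"

lemma integral_S: "(\<integral>x. S n x \<partial>\<mu>) = real n * f_mean"
proof -
  have "S 1 = f" by (rule ext) simp
  then have i: "integrable \<mu> f" using integrable_S[of 1] by simp
  have k: "(\<integral>x. f ((shift ^^ k) x) \<partial>\<mu>) = f_mean" for k
    using integral_distr[OF shift_pow_meas meas_f, of k] by (simp add: f_mean_def shift_pow_distr)
  have "integrable \<mu> (\<lambda>x. f ((shift ^^ k) x))" for k
    using integrable_distr[OF shift_pow_meas, of k f] i by (simp add: shift_pow_distr)
  then show ?thesis
    unfolding birkhoff_def by (subst Bochner_Integration.integral_sum) (simp_all add: k)
qed

text \<open>The positive part of the centred sum has mean at least \<open>\<delta>\<surd>n(1 - p)\<close>, where \<open>p\<close> is the probability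
  in question, whereas the linear variance bounds it by a multiple of \<open>\<surd>(pn)\<close>.\<close>
lemma lower_tail:
  assumes "\<delta> > 0"
  shows "\<exists>c>0. \<forall>n\<ge>1. c \<le> measure \<mu> {x \<in> X. S n x - real n * f_mean \<ge> - \<delta> * sqrt (real n)}"
proof -
  obtain V where V: "V > 0" "\<And>n. \<exists>a. (\<integral>x. (S n x - a)\<^sup>2 \<partial>\<mu>) \<le> V * (real n + 1)"
    using variance_linear by blast
  define c where "c = (\<delta> / 2) / (V / \<delta> + \<delta>)"
  have "c \<le> measure \<mu> {x \<in> X. S n x - real n * f_mean \<ge> - \<delta> * sqrt (real n)}" if n: "n \<ge> 1" for n
  proof -
    let ?Q = "{x \<in> X. S n x - real n * f_mean \<ge> - \<delta> * sqrt (real n)}"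
    let ?Y = "\<lambda>x. S n x - real n * f_mean"
    define p where "p = measure \<mu> ?Q"
    have "?Q = {x \<in> space \<mu>. S n x - real n * f_mean \<ge> - \<delta> * sqrt (real n)}" by (simp add: space_mu)
    also have "\<dots> \<in> sets \<mu>" by measurable
    finally have Q: "?Q \<in> sets \<mu>" .
    have Y0: "(\<integral>x. ?Y x \<partial>\<mu>) = 0"
      using integral_S[of n] integrable_S[of n] prob_space by simp
    have iY: "integrable \<mu> ?Y" using integrable_S[of n] by simp
    have iY2: "integrable \<mu> (\<lambda>x. (?Y x)\<^sup>2)" by (rule integrable_S2)
    have iQ: "integrable \<mu> (indicator ?Q :: seq \<Rightarrow> real)"
      using Q by (simp add: integrable_indicator_iff emeasure_eq_measure)
    \<comment> \<open>The expectation minimises the quadratic deviation, so it may replace the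
      unknown centre a.\<close>
    have var: "(\<integral>x. (?Y x)\<^sup>2 \<partial>\<mu>) \<le> 2 * V * real n"
    proof -
      obtain a where a: "(\<integral>x. (S n x - a)\<^sup>2 \<partial>\<mu>) \<le> V * (real n + 1)" using V(2) by blast
      have "(\<integral>x. (S n x - a)\<^sup>2 \<partial>\<mu>) = (\<integral>x. (?Y x)\<^sup>2 + 2 * (real n * f_mean - a) * ?Y x + (real n * f_mean - a)\<^sup>2 \<partial>\<mu>)"
        by (rule Bochner_Integration.integral_cong) (simp_all add: power2_eq_square algebra_simps)
      also have "\<dots> = (\<integral>x. (?Y x)\<^sup>2 \<partial>\<mu>) + 2 * (real n * f_mean - a) * (\<integral>x. ?Y x \<partial>\<mu>) + (real n * f_mean - a)\<^sup>2"
        using iY iY2 prob_space by (simp only: Bochner_Integration.integral_add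
          Bochner_Integration.integrable_add integrable_mult_right integral_mult_right_zero integrable_const lebesgue_integral_const) simp
      finally have "(\<integral>x. (?Y x)\<^sup>2 \<partial>\<mu>) \<le> V * (real n + 1)"
        using a zero_le_power2[of "real n * f_mean - a"] unfolding Y0 by linarith
      also have "\<dots> \<le> V * (2 * real n)" using V(1) n by (intro mult_left_mono) auto
      finally show ?thesis by simp
    qed
    \<comment> \<open>This t gives the bound for the quadratic term the value \<delta> sqrt n / 2,
      half of the gain \<delta> sqrt n.\<close>
    define t where "t = \<delta> / (2 * V * sqrt (real n))"
    have sn: "sqrt (real n) > 0" using n by simp
    have t: "t > 0" using assms V(1) sn by (simp add: t_def)
    have "(\<integral>x. ?Y x \<partial>\<mu>) \<le> (\<integral>x. t / 2 * (?Y x)\<^sup>2 + (1 / (2 * t) + \<delta> * sqrt (real n)) * indicator ?Q x - \<delta> * sqrt (real n) \<partial>\<mu>)"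
    proof (rule integral_mono[OF iY])
      show "integrable \<mu> (\<lambda>x. t / 2 * (?Y x)\<^sup>2 + (1 / (2 * t) + \<delta> * sqrt (real n)) * indicator ?Q x - \<delta> * sqrt (real n))"
        using iY2 iQ by (intro Bochner_Integration.integrable_diff Bochner_Integration.integrable_add integrable_mult_right integrable_const)
      fix x assume "x \<in> space \<mu>"
      then have x: "x \<in> X" by (simp add: space_mu)
      \<comment> \<open>Inside the event 0 \<le> (t Y - 1)^2 is used, outside it Y < - \<delta> sqrt
        n.\<close>
      show "?Y x \<le> t / 2 * (?Y x)\<^sup>2 + (1 / (2 * t) + \<delta> * sqrt (real n)) * indicator ?Q x - \<delta> * sqrt (real n)"
      proof (cases "x \<in> ?Q")
        case True
        have "0 \<le> (t * ?Y x - 1)\<^sup>2 / (2 * t)" using t by simp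
        also have "\<dots> = t / 2 * (?Y x)\<^sup>2 + 1 / (2 * t) - ?Y x"
          using t by (simp add: power2_eq_square field_simps)
        finally show ?thesis using True by simp
      next
        case False
        then have "?Y x \<le> - \<delta> * sqrt (real n)" using x by simp
        moreover have "0 \<le> t / 2 * (?Y x)\<^sup>2" using t by simp
        ultimately show ?thesis using False by simp
      qed
    qed
    also have "\<dots> = t / 2 * (\<integral>x. (?Y x)\<^sup>2 \<partial>\<mu>) + (1 / (2 * t) + \<delta> * sqrt (real n)) * p - \<delta> * sqrt (real n)"
    proof -
      have "(\<integral>x. indicator ?Q x \<partial>\<mu>) = p"
        using sets.sets_into_space[OF Q] by (simp add: p_def Int_absorb2)
      then show ?thesis
        using iY2 iQ prob_space
        by (subst Bochner_Integration.integral_diff, simp, simp, subst Bochner_Integration.integral_add) simp_all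
    qed
    also have "\<dots> \<le> t / 2 * (2 * V * real n) + (1 / (2 * t) + \<delta> * sqrt (real n)) * p - \<delta> * sqrt (real n)"
      using t by (intro diff_mono add_mono mult_left_mono[OF var] order_refl) simp
    also have "t / 2 * (2 * V * real n) = \<delta> * sqrt (real n) / 2"
    proof -
      have "real n = sqrt (real n) * sqrt (real n)" by simp
      then show ?thesis using V(1) sn unfolding t_def by (simp add: field_simps)
    qed
    also have "1 / (2 * t) = V / \<delta> * sqrt (real n)" using assms by (simp add: t_def)
    finally have "0 \<le> sqrt (real n) * ((V / \<delta> + \<delta>) * p - \<delta> / 2)"
      unfolding Y0 by (simp add: algebra_simps)
    then have "\<delta> / 2 \<le> (V / \<delta> + \<delta>) * p" using sn by (simp add: zero_le_mult_iff)
    moreover have "V / \<delta> + \<delta> > 0" using V(1) assms by (simp add: add_pos_pos)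
    ultimately show ?thesis
      unfolding c_def p_def[symmetric] by (subst pos_divide_le_eq) (simp_all only: mult.commute)
  qed
  moreover have "c > 0" using V(1) assms by (simp add: c_def add_pos_pos)
  ultimately show ?thesis by blast
qed

lemma ln_m_bounds:
  assumes "x \<in> X"
  shows "\<bar>ln (m (prefix x n)) - (S n x - real n * P)\<bar> \<le> ln C"
proof -
  let ?y = "S n x - real n * P"
  have mp: "m (prefix x n) > 0" by (rule m_pos[OF prefix_words[OF assms]])
  have "ln (exp ?y) \<le> ln (C * m (prefix x n))"
    using gibbs_lower[OF assms, of n] C mp by (subst ln_le_cancel_iff) auto
  moreover have "ln (m (prefix x n)) \<le> ln (C * exp ?y)"
    using gibbs_upper[OF assms, of n] C mp by (subst ln_le_cancel_iff) auto
  ultimately show ?thesis using C mp by (simp add: ln_mult abs_le_iff)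
qed

text \<open>\<open>ln m\<close> differs from S n x - n P by at most ln C. Integrated and divided by
  n, this shows that the limit defining the entropy exists, so \<open>lim\<close> has its proper
  value.\<close>

lemma entropy_eq: "entropy_sym K A \<mu> = P - f_mean"
proof -
  have "\<bar>- 1 / real n * (\<Sum>w\<in>wo n. m w * ln (m w)) - (P - f_mean)\<bar> \<le> ln C / real n" if n: "n \<ge> 1" for n
  proof -
    have i: "integrable \<mu> (\<lambda>x. ln (m (prefix x n)))" by (rule integrable_prefix)
    have "(\<Sum>w\<in>wo n. m w * ln (m w)) - real n * (f_mean - P)
        = (\<integral>x. ln (m (prefix x n)) - (S n x - real n * P) \<partial>\<mu>)"
      using i integrable_S[of n] prob_space integral_S[of n]
      by (simp add: integral_prefix[of "\<lambda>w. ln (m w)" n] algebra_simps)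
    also have "\<bar>\<dots>\<bar> \<le> (\<integral>x. \<bar>ln (m (prefix x n)) - (S n x - real n * P)\<bar> \<partial>\<mu>)"
      by (rule integral_abs_bound)
    also have "\<dots> \<le> (\<integral>x. ln C \<partial>\<mu>)"
      using i integrable_S[of n] ln_m_bounds by (intro integral_mono) (auto simp: space_mu)
    also have "\<dots> = ln C" using prob_space by simp
    finally have le: "\<bar>(\<Sum>w\<in>wo n. m w * ln (m w)) - real n * (f_mean - P)\<bar> \<le> ln C" .
    have "- 1 / real n * (\<Sum>w\<in>wo n. m w * ln (m w)) - (P - f_mean)
        = - (((\<Sum>w\<in>wo n. m w * ln (m w)) - real n * (f_mean - P)) / real n)"
      using n by (simp add: field_simps)
    then show ?thesis using le n by (simp add: divide_right_mono)
  qed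
  then have "(\<lambda>n. - 1 / real n * (\<Sum>w\<in>wo n. m w * ln (m w)) - (P - f_mean)) \<longlonglongrightarrow> 0"
    by (intro Lim_null_comparison[OF _ lim_const_over_n[of "ln C"]])
      (auto intro!: eventually_sequentiallyI[of 1])
  then have "(\<lambda>n. - 1 / real n * (\<Sum>w\<in>wo n. m w * ln (m w))) \<longlonglongrightarrow> P - f_mean"
    by (simp add: LIM_zero_iff)
  then show ?thesis unfolding entropy_sym_def by (rule limI)
qed

text \<open>The tail bound is applied to the orbit after j + G steps, which is quasi-independent of
  the event of depth j. The constant does not depend on j; only the threshold N does.\<close>

lemma cylinder_lower_tail:
  assumes "\<delta> > 0"
  shows "\<exists>c>0. \<forall>j U. \<exists>N. \<forall>n\<ge>N. c * measure \<mu> (cset j U) \<le>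
    measure \<mu> (cset j U \<inter> cset n {w. ln (m w) \<ge> - (P - f_mean) * real n - \<delta> * sqrt (real n)})"
proof -
  obtain c where c: "c > 0" "\<And>n. n \<ge> 1 \<Longrightarrow> c \<le> measure \<mu> {x \<in> X. S n x - real n * f_mean \<ge> - (\<delta> / 2) * sqrt (real n)}"
    using lower_tail[of "\<delta> / 2"] assms by auto
  have "\<exists>N. \<forall>n\<ge>N. c1 * c * measure \<mu> (cset j U) \<le>
    measure \<mu> (cset j U \<inter> cset n {w. ln (m w) \<ge> - (P - f_mean) * real n - \<delta> * sqrt (real n)})" for j U
  proof -
    \<comment> \<open>D collects the distortion, the first j + G steps and ln C; N is so large that
      D uses up at most half of \<delta> sqrt n.\<close>
    define D where "D = B + real (j + G) * (F + \<bar>f_mean\<bar>) + ln C"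
    define N where "N = max (j + G + 1) (nat \<lceil>(2 * D / \<delta>)\<^sup>2\<rceil>)"
    have "c1 * c * measure \<mu> (cset j U) \<le>
      measure \<mu> (cset j U \<inter> cset n {w. ln (m w) \<ge> - (P - f_mean) * real n - \<delta> * sqrt (real n)})" if n: "n \<ge> N" for n
    proof -
      define n' where "n' = n - (j + G)"
      have nn: "n = j + G + n'" "n' \<ge> 1" using n by (auto simp: n'_def N_def)
      have "(2 * D / \<delta>)\<^sup>2 \<le> real n" using n unfolding N_def by linarith
      then have "2 * D / \<delta> \<le> sqrt (real n)" by (rule real_le_rsqrt)
      then have Dn: "D \<le> \<delta> / 2 * sqrt (real n)" using assms by (simp add: field_simps)
      let ?E = "{x \<in> X. S n' x - real n' * f_mean \<ge> - (\<delta> / 2) * sqrt (real n')}"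
      let ?V = "(\<lambda>x. prefix x n') ` ?E"
      have "measure \<mu> ?E \<le> measure \<mu> (cset n' ?V)"
      proof (rule finite_measure_mono)
        show "?E \<subseteq> cset n' ?V" by (auto simp: cset_def)
      qed (rule meas_cset)
      then have cV: "c \<le> measure \<mu> (cset n' ?V)" using c(2)[OF nn(2)] by linarith
      have "c1 * c * measure \<mu> (cset j U) \<le> c1 * measure \<mu> (cset j U) * measure \<mu> (cset n' ?V)"
        using mult_left_mono[OF cV, of "c1 * measure \<mu> (cset j U)"] c1_pos by (simp add: mult_ac)
      also have "\<dots> \<le> measure \<mu> {x \<in> cset j U. (shift ^^ (j + G)) x \<in> cset n' ?V}"
        by (rule quasi_indep_lower)
      also have "\<dots> \<le> measure \<mu> (cset j U \<inter> cset n {w. ln (m w) \<ge> - (P - f_mean) * real n - \<delta> * sqrt (real n)})"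
      proof (intro finite_measure_mono subsetI)
        fix x assume "x \<in> {x \<in> cset j U. (shift ^^ (j + G)) x \<in> cset n' ?V}"
        then obtain y where x: "x \<in> cset j U" and y: "y \<in> ?E" "prefix ((shift ^^ (j + G)) x) n' = prefix y n'"
          by (auto simp: cset_def)
        have xX: "x \<in> X" using x by (simp add: cset_def)
        let ?z = "(shift ^^ (j + G)) x"
        have "\<bar>S n' ?z - S n' y\<bar> \<le> B * \<alpha> ^ 0"
          using y by (intro bounded_distortion shift_X xX) (auto simp: prefix_eq_iff)
        then have "\<bar>S n' ?z - S n' y\<bar> \<le> B" by simp
        moreover have "\<bar>S (j + G) x\<bar> \<le> real (j + G) * F" by (rule S_bound[OF xX])
        moreover have "S n x = S (j + G) x + S n' ?z" unfolding nn(1) by (rule birkhoff_add)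
        moreover have "\<bar>ln (m (prefix x n)) - (S n x - real n * P)\<bar> \<le> ln C" by (rule ln_m_bounds[OF xX])
        moreover have "S n' y \<ge> real n' * f_mean - \<delta> / 2 * sqrt (real n')" using y(1) by simp
        moreover have "\<delta> / 2 * sqrt (real n') \<le> \<delta> / 2 * sqrt (real n)" using nn assms by simp
        moreover have "real n' * f_mean \<ge> real n * f_mean - real (j + G) * \<bar>f_mean\<bar>"
        proof -
          have "real (j + G) * f_mean \<le> real (j + G) * \<bar>f_mean\<bar>" by (intro mult_left_mono) auto
          moreover have "real n * f_mean = real (j + G) * f_mean + real n' * f_mean" unfolding nn(1) by (simp add: algebra_simps)
          ultimately show ?thesis by simp
        qed
        moreover have "real (j + G) * (F + \<bar>f_mean\<bar>) = real (j + G) * F + real (j + G) * \<bar>f_mean\<bar>" by (rule distrib_left)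
        moreover have "\<delta> * sqrt (real n) = \<delta> / 2 * sqrt (real n) + \<delta> / 2 * sqrt (real n)" by simp
        moreover have "- (P - f_mean) * real n = real n * f_mean - real n * P" by (simp add: algebra_simps)
        ultimately have "ln (m (prefix x n)) \<ge> - (P - f_mean) * real n - \<delta> * sqrt (real n)"
          using Dn unfolding D_def by linarith
        then show "x \<in> cset j U \<inter> cset n {w. ln (m w) \<ge> - (P - f_mean) * real n - \<delta> * sqrt (real n)}"
          using x xX by (simp add: cset_def)
      qed auto
      finally show ?thesis .
    qed
    then show ?thesis by blast
  qed
  moreover have "c1 * c > 0" using c1_pos c by simp
  ultimately show ?thesis by blast
qed

text \<open>The words in W k are heavy enough for the return estimate, and a uniform proportion of
  every event of finite depth meets them at late levels. For v \<ge> 0 the limsup hypothesis gives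
  proportion 1; for v < 0 the lower tail gives a positive constant.\<close>

lemma returns_almost_surely:
  fixes \<psi> nk :: "nat \<Rightarrow> nat" and g :: "nat \<Rightarrow> real" and v :: real
  defines "h \<equiv> entropy_sym K A \<mu>"
  assumes psi_le: "eventually (\<lambda>n. \<psi> n \<le> n) sequentially"
    and psi_lim: "filterlim \<psi> at_top sequentially"
    and nk: "strict_mono nk" and g_ge: "\<And>n. g n \<ge> 1"
    and limsup_cond: "measure \<mu> {x \<in> X. limsup (\<lambda>k. ereal ((ln (m (prefix x (nk k))) + h * real (nk k))
             / (sqrt (2 * v * real (nk k)) * g (nk k)))) > 1} = 1" (is "measure \<mu> ?L = 1")
    and count_cond: "filterlim (\<lambda>k. real (card (preim \<psi> (nk k))) *
        exp (- h * real (nk k) + sqrt (2 * v * real (nk k)) * g (nk k))) at_top sequentially"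
  shows "measure \<mu> {x \<in> X. infinite {k. x \<in> returns (nk k) (preim \<psi> (nk k))}} = 1"
proof -
  define s where "s k = sqrt (2 * v * real (nk k)) * g (nk k)" for k
  define W where "W k = {w. real (card (preim \<psi> (nk k))) * m w \<ge> 1 + real G}" for k
  \<comment> \<open>As \<psi> tends to infinity its fibres are finite, so \<open>card\<close> is
    their true cardinality and not the default 0.\<close>
  have fin: "finite (preim \<psi> n)" for n
  proof -
    have "eventually (\<lambda>p. \<psi> p > n) sequentially" using psi_lim[unfolded filterlim_at_top, rule_format, of "Suc n"]
      by (simp add: Suc_le_eq)
    then obtain q where q: "\<And>p. p \<ge> q \<Longrightarrow> \<psi> p > n" by (auto simp: eventually_sequentially)
    have "p < q" if "p \<in> preim \<psi> n" for p using q[of p] that by (cases "p < q") (auto simp: preim_def)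
    then have "preim \<psi> n \<subseteq> {..<q}" by blast
    then show ?thesis by (rule finite_subset) simp
  qed
  \<comment> \<open>For large k the fibre lies beyond the finitely many p at which \<psi> p \<le> p
    may fail, so nk k = \<psi> p \<le> p on it. The sum over p < q serves as a bound for \<psi>
    there.\<close>
  have late: "eventually (\<lambda>k. \<forall>p\<in>preim \<psi> (nk k). p \<ge> nk k) sequentially"
  proof -
    obtain q where q: "\<And>p. p \<ge> q \<Longrightarrow> \<psi> p \<le> p" using psi_le by (auto simp: eventually_sequentially)
    have "\<forall>p\<in>preim \<psi> (nk k). p \<ge> nk k" if k: "k > (\<Sum>p<q. \<psi> p)" for k
    proof
      fix p assume p: "p \<in> preim \<psi> (nk k)"
      have "\<not> p < q"
      proof
        assume "p < q"
        then have "\<psi> p \<le> (\<Sum>p<q. \<psi> p)" by (intro member_le_sum) auto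
        moreover have "\<psi> p \<ge> k" using p strict_mono_imp_increasing[OF nk, of k] by (simp add: preim_def)
        ultimately show False using k by simp
      qed
      then show "nk k \<le> p" using q[of p] p by (simp add: preim_def)
    qed
    then show ?thesis by (intro eventually_sequentiallyI[of "Suc (\<Sum>p<q. \<psi> p)"]) auto
  qed
  have "eventually (\<lambda>k. real (card (preim \<psi> (nk k))) * exp (- h * real (nk k) + s k) \<ge> 1 + real G) sequentially"
    using count_cond by (simp add: filterlim_at_top s_def)
  then obtain k1 where k1: "\<And>k. k \<ge> k1 \<Longrightarrow> real (card (preim \<psi> (nk k))) * exp (- h * real (nk k) + s k) \<ge> 1 + real G"
    by (auto simp: eventually_sequentially)
  have good: "prefix x (nk k) \<in> W k"
    if k: "k \<ge> k1" and x: "x \<in> X" and ln: "ln (m (prefix x (nk k))) \<ge> - h * real (nk k) + s k" for k x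
  proof -
    have mp: "m (prefix x (nk k)) > 0" by (rule m_pos[OF prefix_words[OF x]])
    have "exp (- h * real (nk k) + s k) \<le> m (prefix x (nk k))"
      using ln mp by (simp add: ln_ge_iff)
    then have "real (card (preim \<psi> (nk k))) * exp (- h * real (nk k) + s k)
        \<le> real (card (preim \<psi> (nk k))) * m (prefix x (nk k))" by (intro mult_left_mono) auto
    with k1[OF k] show ?thesis by (simp add: W_def)
  qed
  have "\<exists>c0>0. \<forall>j U k0. c0 * measure \<mu> (cset j U) \<le> measure \<mu> (cset j U \<inter> (\<Union>k\<in>{k0..}. cset (nk k) (W k)))"
  proof (cases "v \<ge> 0")
    case True
    have L: "?L \<in> sets \<mu>" using limsup_cond measure_notin_sets[of ?L \<mu>] by fastforce
    have "measure \<mu> (cset j U) \<le> measure \<mu> (cset j U \<inter> (\<Union>k\<in>{k0..}. cset (nk k) (W k)))" for j U k0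
    proof -
      have sub: "?L \<subseteq> (\<Union>k\<in>{k0..}. cset (nk k) (W k))"
      proof
        fix x assume xL: "x \<in> ?L"
        let ?f = "\<lambda>k. (ln (m (prefix x (nk k))) + h * real (nk k)) / s k"
        have x: "x \<in> X" and gt: "limsup (\<lambda>k. ereal (?f k)) > 1" using xL by (auto simp: s_def)
        have "\<not> eventually (\<lambda>k. ereal (?f k) \<le> 1) sequentially"
          using Limsup_bounded[of "\<lambda>k. ereal (?f k)" 1 sequentially] gt by (auto simp: not_le)
        then obtain k where k: "k \<ge> max k0 k1" "?f k > 1"
          unfolding eventually_sequentially by (metis not_le one_ereal_def ereal_less_eq(3))
        have "s k \<ge> 0" using True g_ge[of "nk k"] by (simp add: s_def)
        \<comment> \<open>If s k were 0, the quotient would have the default value 0 and not exceed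
          1.\<close>
        moreover have "s k \<noteq> 0" using k(2) by auto
        ultimately have "s k > 0" by simp
        then have "ln (m (prefix x (nk k))) \<ge> - h * real (nk k) + s k" using k(2) by (simp add: field_simps)
        then have "prefix x (nk k) \<in> W k" using k x by (intro good) auto
        then show "x \<in> (\<Union>k\<in>{k0..}. cset (nk k) (W k))" using k x by (auto simp: cset_def)
      qed
      let ?B = "\<Union>k\<in>{k0..}. cset (nk k) (W k)"
      have "1 \<le> measure \<mu> ?B" using finite_measure_mono[OF sub] limsup_cond by simp
      then have "measure \<mu> (space \<mu> - ?B) \<le> 0" by (subst prob_compl) auto
      moreover have "measure \<mu> (cset j U) \<le> measure \<mu> (cset j U \<inter> ?B \<union> (space \<mu> - ?B))"
        using cset_subset space_mu by (intro finite_measure_mono) auto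
      moreover have "\<dots> \<le> measure \<mu> (cset j U \<inter> ?B) + measure \<mu> (space \<mu> - ?B)"
        by (intro measure_Un_le) auto
      ultimately show ?thesis by linarith
    qed
    then show ?thesis by (intro exI[of _ 1]) simp
  next
    case False
    define \<delta> where "\<delta> = sqrt (- 2 * v)"
    have \<delta>: "\<delta> > 0" using False by (simp add: \<delta>_def)
    \<comment> \<open>\<open>sqrt\<close> is an odd function, so v < 0 reverses the sign of s k, and
      g \<ge> 1 then gives the bound.\<close>
    have s_le: "s k \<le> - \<delta> * sqrt (real (nk k))" for k
    proof -
      have "sqrt (2 * v * real (nk k)) = - (\<delta> * sqrt (real (nk k)))"
        unfolding \<delta>_def real_sqrt_mult[symmetric] real_sqrt_minus[symmetric] by simp
      moreover have "\<delta> * sqrt (real (nk k)) * 1 \<le> \<delta> * sqrt (real (nk k)) * g (nk k)"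
        using \<delta> g_ge by (intro mult_left_mono) auto
      ultimately show ?thesis by (simp add: s_def)
    qed
    obtain c where c: "c > 0" "\<And>j U. \<exists>N. \<forall>n\<ge>N. c * measure \<mu> (cset j U) \<le>
        measure \<mu> (cset j U \<inter> cset n {w. ln (m w) \<ge> - h * real n - \<delta> * sqrt (real n)})"
      using cylinder_lower_tail[OF \<delta>] unfolding h_def entropy_eq by blast
    have "c * measure \<mu> (cset j U) \<le> measure \<mu> (cset j U \<inter> (\<Union>k\<in>{k0..}. cset (nk k) (W k)))" for j U k0
    proof -
      obtain N where N: "\<And>n. n \<ge> N \<Longrightarrow> c * measure \<mu> (cset j U) \<le>
        measure \<mu> (cset j U \<inter> cset n {w. ln (m w) \<ge> - h * real n - \<delta> * sqrt (real n)})" using c(2) by blast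
      \<comment> \<open>In this case a single late level suffices.\<close>
      define k where "k = max N (max k0 k1)"
      have "nk k \<ge> N" using strict_mono_imp_increasing[OF nk, of k] by (simp add: k_def)
      from N[OF this] have "c * measure \<mu> (cset j U) \<le>
        measure \<mu> (cset j U \<inter> cset (nk k) {w. ln (m w) \<ge> - h * real (nk k) - \<delta> * sqrt (real (nk k))})" .
      also have "\<dots> \<le> measure \<mu> (cset j U \<inter> (\<Union>k\<in>{k0..}. cset (nk k) (W k)))"
      proof (intro finite_measure_mono subsetI)
        fix x assume x: "x \<in> cset j U \<inter> cset (nk k) {w. ln (m w) \<ge> - h * real (nk k) - \<delta> * sqrt (real (nk k))}"
        then have "prefix x (nk k) \<in> W k" using s_le[of k] by (intro good) (auto simp: cset_def k_def)
        then have "x \<in> cset (nk k) (W k)" using x by (simp add: cset_def)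
        then show "x \<in> cset j U \<inter> (\<Union>k\<in>{k0..}. cset (nk k) (W k))" using x by (auto simp: k_def)
      qed auto
      finally show ?thesis .
    qed
    then show ?thesis using c(1) by blast
  qed
  then obtain c0 where c0: "c0 > 0" "\<And>j U k0. c0 * measure \<mu> (cset j U)
      \<le> measure \<mu> (cset j U \<inter> (\<Union>k\<in>{k0..}. cset (nk k) (W k)))" by blast
  show ?thesis
    by (rule returns_infinitely_often[OF nk fin late _ c0]) (simp add: W_def)
qed

text \<open>Measurability lets \<open>R_psi\<close> inherit full measure from a subset;
  \<open>measure\<close> would be 0 on a set that is not measurable.\<close>

lemma meas_R_psi: "R_psi K A \<psi> \<in> sets \<mu>"
proof -
  have "R_psi K A \<psi> = X \<inter> (\<Inter>N. \<Union>n\<in>{max 1 N..}. returns (\<psi> n) {n})"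
  proof -
    have "dist_sym K ((shift ^^ n) x) x \<le> 1 / real K ^ \<psi> n \<longleftrightarrow> x \<in> returns (\<psi> n) {n}" if "x \<in> X" for x n
      unfolding dist_sym_le_iff[OF K2] using that by (simp add: returns_def shift_pow)
    then show ?thesis
      unfolding R_psi_def infinite_nat_iff_unbounded_le by (auto simp: Bex_def; metis)
  qed
  also have "\<dots> \<in> sets \<mu>" by auto
  finally show ?thesis .
qed

end

section \<open>From the stated definitions to the locales, and the conclusion\<close>

lemma mat_pow_Suc: "mat_pow K A (Suc m) a b = (\<Sum>c\<in>{1..K}. mat_pow K A m a c * A c b)"
  by (simp add: mat_pow_def)

text \<open>A positive entry of the matrix power has a nonzero summand, whose index is the last
  symbol before b; induction continues the path backwards.\<close>

lemma mat_pow_path: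
  assumes A01: "\<And>a b. a \<in> {1..K} \<Longrightarrow> b \<in> {1..K} \<Longrightarrow> A a b \<in> {0, 1}"
    and "a \<in> {1..K}" "b \<in> {1..K}" "mat_pow K A m a b > 0"
  shows "\<exists>\<pi>. \<pi> 0 = a \<and> \<pi> m = b \<and> (\<forall>i<m. A (\<pi> i) (\<pi> (Suc i)) = 1) \<and> (\<forall>i. \<pi> i \<in> {1..K})"
  using assms(3,4)
proof (induction m arbitrary: b)
  case 0
  then have "a = b" by (simp add: mat_pow_def split: if_splits)
  then show ?case using assms(2) by (intro exI[of _ "\<lambda>_. a"]) auto
next
  case (Suc m)
  have "\<exists>c\<in>{1..K}. mat_pow K A m a c * A c b \<noteq> 0"
  proof (rule ccontr)
    assume "\<not> ?thesis"
    then have "(\<Sum>c\<in>{1..K}. mat_pow K A m a c * A c b) = 0" by (intro sum.neutral) blast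
    with Suc.prems(2) show False unfolding mat_pow_Suc by linarith
  qed
  then obtain c where c: "c \<in> {1..K}" "mat_pow K A m a c > 0" "A c b \<noteq> 0" by auto
  then have Acb: "A c b = 1" using A01[OF c(1) Suc.prems(1)] by simp
  obtain \<pi> where \<pi>: "\<pi> 0 = a" "\<pi> m = c" "\<forall>i<m. A (\<pi> i) (\<pi> (Suc i)) = 1" "\<forall>i. \<pi> i \<in> {1..K}"
    using Suc.IH[OF c(1,2)] by blast
  have "A ((\<pi>(Suc m := b)) i) ((\<pi>(Suc m := b)) (Suc i)) = 1" if "i < Suc m" for i
    using that \<pi>(2,3) Acb by (cases "i = m") auto
  moreover have "(\<pi>(Suc m := b)) i \<in> {1..K}" for i
    using \<pi>(4) Suc.prems(1) by simp
  ultimately show ?case using \<pi>(1) by (intro exI[of _ "\<pi>(Suc m := b)"]) auto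
qed

lemma admissible_subshift:
  assumes K: "K \<ge> 2" and A: "admissible_matrix K A"
  shows "\<exists>G. subshift K A G"
proof -
  have A01: "\<And>a b. a \<in> {1..K} \<Longrightarrow> b \<in> {1..K} \<Longrightarrow> A a b \<in> {0, 1}"
    using A by (simp add: admissible_matrix_def)
  obtain M where M: "\<And>a b. a \<in> {1..K} \<Longrightarrow> b \<in> {1..K} \<Longrightarrow> mat_pow K A M a b > 0"
    using A unfolding admissible_matrix_def by blast
  \<comment> \<open>The power 0 is the identity matrix, whose entry at (1, 2) is 0; so M is a
    successor and G = M - 1.\<close>
  have "M \<noteq> 0"
  proof
    assume "M = 0"
    with M[of 1 2] K show False by (simp add: mat_pow_def)
  qed
  then obtain G where G: "M = Suc G" using not0_implies_Suc by blast
  have "subshift K A G"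
  proof
    fix a b assume ab: "a \<in> {1..K}" "b \<in> {1..K}"
    from mat_pow_path[OF A01 ab M[OF ab]] G
    show "\<exists>\<pi>. \<pi> 0 = a \<and> \<pi> (Suc G) = b \<and> (\<forall>i\<le>G. A (\<pi> i) (\<pi> (Suc i)) = 1) \<and> (\<forall>i. \<pi> i \<in> {1..K})"
      by (simp add: less_Suc_eq_le)
  qed (rule K)
  then show ?thesis by blast
qed

text \<open>Distinct sequences that agree on n symbols have \<open>agree_len\<close> \<ge> n, and
  powers of \<alpha> < 1 decrease; for equal sequences the bound is trivial.\<close>

lemma holder_variation:
  assumes "holder K A f"
  obtains b \<alpha> where "b > 0" "0 < \<alpha>" "\<alpha> < 1"
    "\<And>x y n. x \<in> SigmaA K A \<Longrightarrow> y \<in> SigmaA K A \<Longrightarrow> (\<forall>j<n. x j = y j) \<Longrightarrow> \<bar>f x - f y\<bar> \<le> b * \<alpha> ^ n"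
proof -
  obtain b \<alpha> where b: "b > 0" "0 < \<alpha>" "\<alpha> < 1"
    "\<And>x y. x \<in> SigmaA K A \<Longrightarrow> y \<in> SigmaA K A \<Longrightarrow> x \<noteq> y \<Longrightarrow> \<bar>f x - f y\<bar> \<le> b * \<alpha> ^ agree_len x y"
    using assms unfolding holder_def by blast
  have "\<bar>f x - f y\<bar> \<le> b * \<alpha> ^ n"
    if xy: "x \<in> SigmaA K A" "y \<in> SigmaA K A" "\<forall>j<n. x j = y j" for x y n
  proof (cases "x = y")
    case True
    then show ?thesis using b by simp
  next
    case False
    then obtain j where "x j \<noteq> y j" by blast
    then have "x (agree_len x y) \<noteq> y (agree_len x y)"
      unfolding agree_len_def by (rule LeastI[of "\<lambda>n. x n \<noteq> y n"])
    then have "n \<le> agree_len x y" using xy(3) not_le by blast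
    then have "\<alpha> ^ agree_len x y \<le> \<alpha> ^ n" using b by (intro power_decreasing) auto
    then have "b * \<alpha> ^ agree_len x y \<le> b * \<alpha> ^ n" using b(1) by simp
    then show ?thesis using b(4)[OF xy(1,2) False] by linarith
  qed
  then show ?thesis using that b by blast
qed

theorem theorem2p2:
  fixes K :: nat and A :: "nat \<Rightarrow> nat \<Rightarrow> nat" and f :: "seq \<Rightarrow> real"
    and \<mu> :: "seq measure" and \<psi> :: "nat \<Rightarrow> nat"
    and nk :: "nat \<Rightarrow> nat" and g :: "nat \<Rightarrow> real"
  assumes K: "K \<ge> 2"
    and A: "admissible_matrix K A"
    and f_holder: "holder K A f"
    and f_noncoh: "\<not> cohomologous_const K A f"
    and gibbs: "gibbs_measure K A f \<mu>"
    and psi_le: "eventually (\<lambda>n. \<psi> n \<le> n) sequentially"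
    and psi_lim: "filterlim \<psi> at_top sequentially"
    and nk_incr: "strict_mono nk"
    and g_ge: "\<And>n. g n \<ge> 1"
    and g_ratio: "(\<lambda>n. g n / g (Suc n)) \<longlonglongrightarrow> 1"
    and limsup_cond: "measure \<mu> {x \<in> SigmaA K A.
        limsup (\<lambda>k. ereal ((ln (measure \<mu> (cyl K A (prefix x (nk k))))
                              + entropy_sym K A \<mu> * real (nk k))
             / (sqrt (2 * variance_sym f \<mu> * real (nk k)) * g (nk k)))) > 1} = 1"
    and count_cond: "filterlim (\<lambda>k. real (card (preim \<psi> (nk k))) *
        exp (- entropy_sym K A \<mu> * real (nk k)
             + sqrt (2 * variance_sym f \<mu> * real (nk k)) * g (nk k))) at_top sequentially"
  shows "measure \<mu> {x \<in> SigmaA K A. infinite {k. \<exists>p\<in>preim \<psi> (nk k).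
            dist_sym K ((shift ^^ p) x) x \<le> 1 / real K ^ nk k}} = 1
         \<and> measure \<mu> (R_psi K A \<psi>) = 1"
proof -
  obtain G where "subshift K A G" using admissible_subshift[OF K A] by blast
  then interpret subshift K A G .
  obtain b \<alpha> where b: "b > 0" "0 < \<alpha>" "\<alpha> < 1"
    "\<And>x y n. x \<in> SigmaA K A \<Longrightarrow> y \<in> SigmaA K A \<Longrightarrow> (\<forall>j<n. x j = y j) \<Longrightarrow> \<bar>f x - f y\<bar> \<le> b * \<alpha> ^ n"
    using holder_variation[OF f_holder] by metis
  from gibbs obtain C where C: "C > 1" and
    ratio: "\<And>x n. x \<in> SigmaA K A \<Longrightarrow>
        inverse C \<le> measure \<mu> (cyl K A (prefix x n)) / exp (- real n * pressure K A f + birkhoff f n x) \<and>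
        measure \<mu> (cyl K A (prefix x n)) / exp (- real n * pressure K A f + birkhoff f n x) \<le> C"
    unfolding gibbs_measure_def by blast
  interpret prob_space \<mu> using gibbs unfolding gibbs_measure_def by blast
  interpret gibbs_system K A G \<mu> f b \<alpha> "pressure K A f" C
  proof
    show "sets \<mu> = sets (cyl_space K A)" "shift \<in> \<mu> \<rightarrow>\<^sub>M \<mu>" "distr \<mu> \<mu> shift = \<mu>"
      using gibbs unfolding gibbs_measure_def by blast+
    fix x n assume x: "x \<in> SigmaA K A"
    have "birkhoff f n x - real n * pressure K A f = - real n * pressure K A f + birkhoff f n x" by simp
    then show "exp (birkhoff f n x - real n * pressure K A f) \<le> C * measure \<mu> (cyl K A (prefix x n))"
      "measure \<mu> (cyl K A (prefix x n)) \<le> C * exp (birkhoff f n x - real n * pressure K A f)"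
      using ratio[OF x, of n] C by (simp_all add: field_simps)
  qed (use b C in auto)
  let ?R = "{x \<in> X. infinite {k. x \<in> returns (nk k) (preim \<psi> (nk k))}}"
  have R1: "measure \<mu> ?R = 1"
    by (rule returns_almost_surely[OF psi_le psi_lim nk_incr g_ge limsup_cond count_cond])
  have ret: "(\<exists>p\<in>T. dist_sym K ((shift ^^ p) x) x \<le> 1 / real K ^ n) \<longleftrightarrow> x \<in> returns n T" if "x \<in> X" for x T n
    unfolding dist_sym_le_iff[OF K2] using that by (simp add: returns_def shift_pow)
  have "{x \<in> X. infinite {k. \<exists>p\<in>preim \<psi> (nk k). dist_sym K ((shift ^^ p) x) x \<le> 1 / real K ^ nk k}} = ?R"
    using ret by auto
  moreover have "measure \<mu> (R_psi K A \<psi>) = 1"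
  proof -
    \<comment> \<open>A return at a time p with \<psi> p = nk k is one of those counted in
      \<open>R_psi\<close>. As nk is injective, infinitely many k give infinitely many values \<psi>
      p, hence infinitely many times p.\<close>
    have "?R \<subseteq> R_psi K A \<psi>"
    proof
      fix x assume x: "x \<in> ?R"
      let ?k = "{k. x \<in> returns (nk k) (preim \<psi> (nk k))}"
      let ?n = "{n. n \<ge> 1 \<and> dist_sym K ((shift ^^ n) x) x \<le> 1 / real K ^ \<psi> n}"
      have "nk ` ?k \<subseteq> \<psi> ` ?n"
      proof
        fix l assume "l \<in> nk ` ?k"
        then obtain k where k: "l = nk k" "x \<in> returns (nk k) (preim \<psi> (nk k))" by blast
        then obtain p where "p \<in> preim \<psi> (nk k)" "dist_sym K ((shift ^^ p) x) x \<le> 1 / real K ^ nk k"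
          using x ret by blast
        then show "l \<in> \<psi> ` ?n" using k by (intro image_eqI[of _ _ p]) (auto simp: preim_def)
      qed
      moreover have "infinite (nk ` ?k)"
        using x nk_incr by (subst finite_image_iff) (auto intro: strict_mono_imp_inj_on inj_on_subset)
      ultimately have "infinite ?n" using finite_subset by blast
      then show "x \<in> R_psi K A \<psi>" using x by (simp add: R_psi_def)
    qed
    then have "measure \<mu> ?R \<le> measure \<mu> (R_psi K A \<psi>)"
      by (intro finite_measure_mono meas_R_psi)
    then show ?thesis using R1 by (intro antisym) simp_all
  qed
  ultimately show ?thesis using R1 by simp
qed

end
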